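(* Let $(\mathcal C,\mathcal D,\mathcal E,i_*,j^*,i^*,i^!,j_!,j_* )$ be gluing data, and suppose that $\mathcal D$ and $\mathcal E$ are endowed with weight structures, both denoted $w$. Then the classes $$\mathcal C^{w\le0}=\{X\in\mathrm{Obj}\,\mathcal C:\ i^!X\in\mathcal D^{w\le0},\ j^*X\in\mathcal E^{w\le0}\},$$ $$\mathcal C^{w\ge0}=\{X\in\mathrm{Obj}\,\mathcal C:\ i^*X\in\mathcal D^{w\ge0},\ j^*X\in\mathcal E^{w\ge0}\}$$ define a weight structure for $\mathcal C$.
   Context: A weight structure $w$ on a triangulated category $\mathcal C$ is a pair of subclasses $\mathcal C^{w\le 0},\mathcal C^{w\ge 0}\subset\mathrm{Obj}\,\mathcal C$ such that: (i) both are additive and contain all retracts (in $\mathcal C$) of their objects; (ii) $\mathcal C^{w\ge 0}\subset \mathcal C^{w\ge 0}[1]$ and $\mathcal C^{w\le 0}[1]\subset \mathcal C^{w\le 0}$; (iii) $\mathcal C(X,Y)=0$ for $X\in\mathcal C^{w\ge 0}$, $Y\in\mathcal C^{w\le 0}[1]$; (iv) for every $X$ there is a distinguished triangle $B[-1]\to X\to A\to B$ with $A\in\mathcal C^{w\le 0}$, $B\in\mathcal C^{w\ge 0}$. $(\mathcal C,\mathcal D,\mathcal E,i_*,j^*,i^*,i^!,j_!,j_* )$ is called gluing data if: (i) $\mathcal C,\mathcal D,\mathcal E$ are triangulated categories; $i_*:\mathcal D\to\mathcal C$, $j^*:\mathcal C\to\mathcal E$, $i^*:\mathcal C\to\mathcal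 D$, $i^!:\mathcal C\to\mathcal D$, $j_*:\mathcal E\to\mathcal C$, $j_!:\mathcal E\to\mathcal C$ are exact functors; (ii) $i^*$ (resp. $i^!$) is left (resp. right) adjoint to $i_*$; $j_!$ (resp. $j_*$) is left (resp. right) adjoint to $j^*$; (iii) $i_*$ is a full embedding; $j^*$ is isomorphic to the localization functor of $\mathcal C$ by $i_*(\mathcal D)$; (iv) for any $X\in\mathrm{Obj}\,\mathcal C$ the pairs of morphisms $j_!j^*X\to X\to i_*i^*X$ and $i_*i^!X\to X\to j_*j^*X$ (coming from the adjunctions) can be completed to distinguished triangles; (v) $i^*j_!=0$, $i^!j_*=0$; (vi) all of the adjunction transformations $i^*i_*\to\mathrm{id}_{\mathcal D}\to i^!i_*$ and $j^*j_*\to\mathrm{id}_{\mathcal E}\to j^*j_!$ are isomorphisms of functors. *)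

theory Defs
  imports "HOL-Algebra.Group"
begin

section \<open>Categories, functors, natural transformations\<close>

text \<open>Single-sorted arrows with domain and codomain, so distinct hom-sets are disjoint.
  \<^term>\<open>Comp C g f\<close> is ``g after f'' and is unspecified when the two do not compose.\<close>

record ('o, 'm) cat_data =
  Obj :: "'o set"
  Mor :: "'m set"
  Dom :: "'m \<Rightarrow> 'o"
  Cod :: "'m \<Rightarrow> 'o"
  Idt :: "'o \<Rightarrow> 'm"
  Comp :: "'m \<Rightarrow> 'm \<Rightarrow> 'm" (infixl \<open>\<cdot>\<index>\<close> 70)

definition Hom :: "('o, 'm, 'x) cat_data_scheme \<Rightarrow> 'o \<Rightarrow> 'o \<Rightarrow> 'm set" where
  "Hom C X Y = {f \<in> Mor C. Dom C f = X \<and> Cod C f = Y}"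

locale category =
  fixes C :: "('o, 'm, 'x) cat_data_scheme" (structure)
  assumes dom_in: "f \<in> Mor C \<Longrightarrow> Dom C f \<in> Obj C"
    and cod_in: "f \<in> Mor C \<Longrightarrow> Cod C f \<in> Obj C"
    and idt_in: "X \<in> Obj C \<Longrightarrow> Idt C X \<in> Hom C X X"
    and comp_in: "\<lbrakk>f \<in> Hom C X Y; g \<in> Hom C Y Z\<rbrakk> \<Longrightarrow> g \<cdot> f \<in> Hom C X Z"
    and comp_idt_right: "f \<in> Hom C X Y \<Longrightarrow> f \<cdot> Idt C X = f"
    and comp_idt_left: "f \<in> Hom C X Y \<Longrightarrow> Idt C Y \<cdot> f = f"
    and comp_assoc: "\<lbrakk>f \<in> Hom C W X; g \<in> Hom C X Y; h \<in> Hom C Y Z\<rbrakk>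
        \<Longrightarrow> h \<cdot> (g \<cdot> f) = (h \<cdot> g) \<cdot> f"

definition is_iso :: "('o, 'm, 'x) cat_data_scheme \<Rightarrow> 'm \<Rightarrow> bool" where
  "is_iso C f \<longleftrightarrow> f \<in> Mor C \<and>
     (\<exists>g \<in> Hom C (Cod C f) (Dom C f).
        Comp C g f = Idt C (Dom C f) \<and> Comp C f g = Idt C (Cod C f))"

definition is_retract :: "('o, 'm, 'x) cat_data_scheme \<Rightarrow> 'o \<Rightarrow> 'o \<Rightarrow> bool" where
  "is_retract C X Y \<longleftrightarrow>
     (\<exists>s \<in> Hom C X Y. \<exists>r \<in> Hom C Y X. Comp C r s = Idt C X)"

definition zero_object :: "('o, 'm, 'x) cat_data_scheme \<Rightarrow> 'o \<Rightarrow> bool" where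
  "zero_object C Z \<longleftrightarrow> Z \<in> Obj C \<and>
     (\<forall>X \<in> Obj C. (\<exists>!f. f \<in> Hom C X Z) \<and> (\<exists>!f. f \<in> Hom C Z X))"

record ('o1, 'm1, 'o2, 'm2) func =
  Fob :: "'o1 \<Rightarrow> 'o2"
  Fmor :: "'m1 \<Rightarrow> 'm2"

definition func_id :: "('o, 'm, 'o, 'm) func" where
  "func_id = \<lparr>Fob = (\<lambda>X. X), Fmor = (\<lambda>f. f)\<rparr>"

definition func_comp ::
    "('o2, 'm2, 'o3, 'm3) func \<Rightarrow> ('o1, 'm1, 'o2, 'm2) func \<Rightarrow> ('o1, 'm1, 'o3, 'm3) func"
    (infixl \<open>\<circ>\<^sub>F\<close> 55) where
  "G \<circ>\<^sub>F F = \<lparr>Fob = Fob G \<circ> Fob F, Fmor = Fmor G \<circ> Fmor F\<rparr>"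

definition is_functor ::
    "('o1, 'm1, 'x) cat_data_scheme \<Rightarrow> ('o2, 'm2, 'y) cat_data_scheme
      \<Rightarrow> ('o1, 'm1, 'o2, 'm2) func \<Rightarrow> bool" where
  "is_functor C D F \<longleftrightarrow>
     (\<forall>X \<in> Obj C. Fob F X \<in> Obj D) \<and>
     (\<forall>X \<in> Obj C. \<forall>Y \<in> Obj C. \<forall>f \<in> Hom C X Y. Fmor F f \<in> Hom D (Fob F X) (Fob F Y)) \<and>
     (\<forall>X \<in> Obj C. Fmor F (Idt C X) = Idt D (Fob F X)) \<and>
     (\<forall>X \<in> Obj C. \<forall>Y \<in> Obj C. \<forall>Z \<in> Obj C. \<forall>f \<in> Hom C X Y. \<forall>g \<in> Hom C Y Z.
        Fmor F (Comp C g f) = Comp D (Fmor F g) (Fmor F f))"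

definition nat_trans ::
    "('o1, 'm1, 'x) cat_data_scheme \<Rightarrow> ('o2, 'm2, 'y) cat_data_scheme
      \<Rightarrow> ('o1, 'm1, 'o2, 'm2) func \<Rightarrow> ('o1, 'm1, 'o2, 'm2) func \<Rightarrow> ('o1 \<Rightarrow> 'm2) \<Rightarrow> bool" where
  "nat_trans C D F G \<tau> \<longleftrightarrow>
     (\<forall>X \<in> Obj C. \<tau> X \<in> Hom D (Fob F X) (Fob G X)) \<and>
     (\<forall>X \<in> Obj C. \<forall>Y \<in> Obj C. \<forall>f \<in> Hom C X Y.
        Comp D (\<tau> Y) (Fmor F f) = Comp D (Fmor G f) (\<tau> X))"

definition nat_iso ::
    "('o1, 'm1, 'x) cat_data_scheme \<Rightarrow> ('o2, 'm2, 'y) cat_data_scheme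
      \<Rightarrow> ('o1, 'm1, 'o2, 'm2) func \<Rightarrow> ('o1, 'm1, 'o2, 'm2) func \<Rightarrow> ('o1 \<Rightarrow> 'm2) \<Rightarrow> bool" where
  "nat_iso C D F G \<tau> \<longleftrightarrow> nat_trans C D F G \<tau> \<and> (\<forall>X \<in> Obj C. is_iso D (\<tau> X))"

definition fully_faithful ::
    "('o1, 'm1, 'x) cat_data_scheme \<Rightarrow> ('o2, 'm2, 'y) cat_data_scheme
      \<Rightarrow> ('o1, 'm1, 'o2, 'm2) func \<Rightarrow> bool" where
  "fully_faithful C D F \<longleftrightarrow> is_functor C D F \<and>
     (\<forall>X \<in> Obj C. \<forall>Y \<in> Obj C.
        bij_betw (Fmor F) (Hom C X Y) (Hom D (Fob F X) (Fob F Y)))"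

definition is_equivalence ::
    "('o1, 'm1, 'x) cat_data_scheme \<Rightarrow> ('o2, 'm2, 'y) cat_data_scheme
      \<Rightarrow> ('o1, 'm1, 'o2, 'm2) func \<Rightarrow> bool" where
  "is_equivalence C D G \<longleftrightarrow> is_functor C D G \<and>
     (\<exists>H. is_functor D C H \<and>
        (\<exists>\<tau>. nat_iso C C func_id (H \<circ>\<^sub>F G) \<tau>) \<and>
        (\<exists>\<sigma>. nat_iso D D (G \<circ>\<^sub>F H) func_id \<sigma>))"

text \<open>\<open>L : C \<rightarrow> D\<close> is left adjoint to \<open>R : D \<rightarrow> C\<close> with unit \<open>\<eta>\<close> and counit \<open>\<epsilon>\<close>.\<close>

definition adjunction ::
    "('o1, 'm1, 'x) cat_data_scheme \<Rightarrow> ('o2, 'm2, 'y) cat_data_scheme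
      \<Rightarrow> ('o1, 'm1, 'o2, 'm2) func \<Rightarrow> ('o2, 'm2, 'o1, 'm1) func
      \<Rightarrow> ('o1 \<Rightarrow> 'm1) \<Rightarrow> ('o2 \<Rightarrow> 'm2) \<Rightarrow> bool" where
  "adjunction C D L R \<eta> \<epsilon> \<longleftrightarrow>
     is_functor C D L \<and> is_functor D C R \<and>
     nat_trans C C func_id (R \<circ>\<^sub>F L) \<eta> \<and>
     nat_trans D D (L \<circ>\<^sub>F R) func_id \<epsilon> \<and>
     (\<forall>X \<in> Obj C. Comp D (\<epsilon> (Fob L X)) (Fmor L (\<eta> X)) = Idt D (Fob L X)) \<and>
     (\<forall>Y \<in> Obj D. Comp C (Fmor R (\<epsilon> Y)) (\<eta> (Fob R Y)) = Idt C (Fob R Y))"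


section \<open>Localization of a category at a class of morphisms\<close>

text \<open>The Gabriel--Zisman construction. A morphism of the localization is a class of zigzags
  (words read from source to target, with letters the morphisms of \<open>C\<close> and formal inverses of
  members of \<open>S\<close>) modulo the smallest congruence that respects identities and composition in
  \<open>C\<close> and makes the formal inverses inverse.\<close>

datatype 'm letter = Fwd 'm | Bwd 'm

primrec zigzag ::
    "('o, 'm, 'x) cat_data_scheme \<Rightarrow> 'm set \<Rightarrow> 'o \<Rightarrow> 'm letter list \<Rightarrow> 'o \<Rightarrow> bool" where
  "zigzag C S X [] Y \<longleftrightarrow> X \<in> Obj C \<and> X = Y"
| "zigzag C S X (a # w) Y \<longleftrightarrow>
     (case a of
        Fwd f \<Rightarrow> f \<in> Mor C \<and> Dom C f = X \<and> zigzag C S (Cod C f) w Y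
      | Bwd s \<Rightarrow> s \<in> S \<and> Cod C s = X \<and> zigzag C S (Dom C s) w Y)"

inductive loc_eq ::
    "('o, 'm, 'x) cat_data_scheme \<Rightarrow> 'm set
      \<Rightarrow> 'o \<Rightarrow> 'o \<Rightarrow> 'm letter list \<Rightarrow> 'm letter list \<Rightarrow> bool"
  for C :: "('o, 'm, 'x) cat_data_scheme" and S :: "'m set" where
  refl: "zigzag C S X w Y \<Longrightarrow> loc_eq C S X Y w w"
| sym: "loc_eq C S X Y v w \<Longrightarrow> loc_eq C S X Y w v"
| trans: "\<lbrakk>loc_eq C S X Y u v; loc_eq C S X Y v w\<rbrakk> \<Longrightarrow> loc_eq C S X Y u w"
| append: "\<lbrakk>loc_eq C S X Y v w; loc_eq C S Y Z v' w'\<rbrakk> \<Longrightarrow> loc_eq C S X Z (v @ v') (w @ w')"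
| idt: "X \<in> Obj C \<Longrightarrow> loc_eq C S X X [Fwd (Idt C X)] []"
| comp: "\<lbrakk>f \<in> Hom C X Y; g \<in> Hom C Y Z\<rbrakk>
    \<Longrightarrow> loc_eq C S X Z [Fwd f, Fwd g] [Fwd (Comp C g f)]"
| fwd_bwd: "s \<in> S \<Longrightarrow> s \<in> Hom C X Y \<Longrightarrow> loc_eq C S X X [Fwd s, Bwd s] []"
| bwd_fwd: "s \<in> S \<Longrightarrow> s \<in> Hom C X Y \<Longrightarrow> loc_eq C S Y Y [Bwd s, Fwd s] []"

definition loc_class ::
    "('o, 'm, 'x) cat_data_scheme \<Rightarrow> 'm set \<Rightarrow> 'o \<Rightarrow> 'o \<Rightarrow> 'm letter list
      \<Rightarrow> 'o \<times> 'o \<times> 'm letter list set" where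
  "loc_class C S X Y w = (X, Y, {v. loc_eq C S X Y w v})"

definition localization ::
    "('o, 'm, 'x) cat_data_scheme \<Rightarrow> 'm set \<Rightarrow> ('o, 'o \<times> 'o \<times> 'm letter list set) cat_data" where
  "localization C S =
     \<lparr>Obj = Obj C,
      Mor = {loc_class C S X Y w | X Y w. zigzag C S X w Y},
      Dom = (\<lambda>(X, Y, W). X),
      Cod = (\<lambda>(X, Y, W). Y),
      Idt = (\<lambda>X. loc_class C S X X []),
      Comp = (\<lambda>(Y', Z, V) (X, Y, W). (X, Z, {u. \<exists>w \<in> W. \<exists>v \<in> V. loc_eq C S X Z (w @ v) u}))\<rparr>"

definition localization_functor ::
    "('o, 'm, 'x) cat_data_scheme \<Rightarrow> 'm set
      \<Rightarrow> ('o, 'm, 'o, 'o \<times> 'o \<times> 'm letter list set) func" where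
  "localization_functor C S =
     \<lparr>Fob = (\<lambda>X. X), Fmor = (\<lambda>f. loc_class C S (Dom C f) (Cod C f) [Fwd f])\<rparr>"

lemma loc_class_eq_iff:
  assumes "zigzag C S X v Y"
  shows "loc_class C S X Y v = loc_class C S X' Y' w \<longleftrightarrow> X = X' \<and> Y = Y' \<and> loc_eq C S X Y v w"
  using assms by (auto simp: loc_class_def intro: loc_eq.intros)

lemma zigzag_append:
  "zigzag C S X v Y \<Longrightarrow> zigzag C S Y w Z \<Longrightarrow> zigzag C S X (v @ w) Z"
  by (induction v arbitrary: X) (auto split: letter.splits)

lemma localization_comp:
  assumes "zigzag C S X v Y" "zigzag C S Y w Z"
  shows "Comp (localization C S) (loc_class C S Y Z w) (loc_class C S X Y v)
       = loc_class C S X Z (v @ w)"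
proof -
  have "{u. \<exists>v' \<in> {v'. loc_eq C S X Y v v'}. \<exists>w' \<in> {w'. loc_eq C S Y Z w w'}.
          loc_eq C S X Z (v' @ w') u} = {u. loc_eq C S X Z (v @ w) u}"
    using assms by (auto intro: loc_eq.intros)
  then show ?thesis by (simp add: localization_def loc_class_def)
qed

lemma localization_Hom:
  "Hom (localization C S) X Y = {loc_class C S X Y w | w. zigzag C S X w Y}"
  by (auto simp: Hom_def localization_def loc_class_def)

text \<open>The construction is a category, the canonical functor to it is a functor, and it inverts
  the members of \<open>S\<close>.\<close>

lemma category_localization:
  assumes "category C" "S \<subseteq> Mor C"
  shows "category (localization C S)"
proof -
  interpret category C by fact
  have ends: "X \<in> Obj C \<and> Y \<in> Obj C" if "zigzag C S X w Y" for X w Y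
    using that by (induction w arbitrary: X)
      (use assms(2) dom_in cod_in in \<open>auto split: letter.splits\<close>)
  have idt: "Idt (localization C S) X = loc_class C S X X []" for X
    by (simp add: localization_def)
  have obj: "Obj (localization C S) = Obj C" by (simp add: localization_def)
  show ?thesis
  proof
    fix f assume "f \<in> Mor (localization C S)"
    then show "Dom (localization C S) f \<in> Obj (localization C S)"
      "Cod (localization C S) f \<in> Obj (localization C S)"
      using ends by (auto simp: localization_def loc_class_def)
  next
    fix X assume "X \<in> Obj (localization C S)"
    then show "Idt (localization C S) X \<in> Hom (localization C S) X X"
      unfolding localization_Hom idt obj by (force intro: exI[of _ "[]"])
  next
    fix f g X Y Z
    assume "f \<in> Hom (localization C S) X Y" "g \<in> Hom (localization C S) Y Z"
    then show "Comp (localization C S) g f \<in> Hom (localization C S) X Z"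
      by (auto simp: localization_Hom localization_comp intro: zigzag_append)
  next
    fix f X Y assume "f \<in> Hom (localization C S) X Y"
    then obtain w where w: "zigzag C S X w Y" "f = loc_class C S X Y w"
      by (auto simp: localization_Hom)
    then have "zigzag C S X [] X" "zigzag C S Y [] Y" using ends by auto
    then show "Comp (localization C S) f (Idt (localization C S) X) = f"
      "Comp (localization C S) (Idt (localization C S) Y) f = f"
      using w by (simp_all add: idt localization_comp del: zigzag.simps)
  next
    fix f g h W X Y Z
    assume "f \<in> Hom (localization C S) W X" "g \<in> Hom (localization C S) X Y"
      "h \<in> Hom (localization C S) Y Z"
    then show "Comp (localization C S) h (Comp (localization C S) g f)
        = Comp (localization C S) (Comp (localization C S) h g) f"
      by (auto simp: localization_Hom localization_comp zigzag_append)
  qed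
qed

lemma is_functor_localization_functor:
  assumes "category C" "S \<subseteq> Mor C"
  shows "is_functor C (localization C S) (localization_functor C S)"
proof -
  interpret category C by fact
  have zz: "zigzag C S X [Fwd f] Y" if "f \<in> Hom C X Y" for f X Y
    using that cod_in by (auto simp: Hom_def)
  have Q: "Fmor (localization_functor C S) f = loc_class C S X Y [Fwd f]"
    if "f \<in> Hom C X Y" for f X Y
    using that by (auto simp: Hom_def localization_functor_def)
  have comp: "Fmor (localization_functor C S) (Comp C g f)
      = Comp (localization C S) (Fmor (localization_functor C S) g)
          (Fmor (localization_functor C S) f)"
    if "f \<in> Hom C X Y" "g \<in> Hom C Y Z" for f g X Y Z
  proof -
    have "loc_eq C S X Z [Fwd (Comp C g f)] [Fwd f, Fwd g]"
      using loc_eq.comp[OF that] by (rule loc_eq.sym)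
    then show ?thesis
      using that zz comp_in[OF that]
      by (simp add: Q[OF that(1)] Q[OF that(2)] Q[OF comp_in[OF that]] localization_comp
          loc_class_eq_iff del: zigzag.simps)
  qed
  have idt: "Fmor (localization_functor C S) (Idt C X) = Idt (localization C S) X"
    if "X \<in> Obj C" for X
    using loc_eq.idt[OF that, of S] zz[OF idt_in[OF that]]
    by (simp add: Q[OF idt_in[OF that]] localization_def loc_class_eq_iff del: zigzag.simps)
  show ?thesis
    unfolding is_functor_def using comp idt zz
    by (auto simp: localization_Hom Q simp del: zigzag.simps)
       (auto simp: localization_def localization_functor_def)
qed

lemma localization_functor_inverts:
  assumes "category C" "S \<subseteq> Mor C" "s \<in> S"
  shows "is_iso (localization C S) (Fmor (localization_functor C S) s)"
proof -
  interpret category C by fact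
  let ?X = "Dom C s" and ?Y = "Cod C s"
  have s: "s \<in> Hom C ?X ?Y" using assms by (auto simp: Hom_def)
  have Q: "Fmor (localization_functor C S) s = loc_class C S ?X ?Y [Fwd s]"
    by (simp add: localization_functor_def)
  have zf: "zigzag C S ?X [Fwd s] ?Y" and zb: "zigzag C S ?Y [Bwd s] ?X"
    using assms dom_in cod_in by auto
  have dc: "Dom (localization C S) (loc_class C S X Y w) = X"
    "Cod (localization C S) (loc_class C S X Y w) = Y" for X Y w
    by (simp_all add: localization_def loc_class_def)
  have idt: "Idt (localization C S) X = loc_class C S X X []" for X
    by (simp add: localization_def)
  have "loc_class C S ?X ?X [Fwd s, Bwd s] = loc_class C S ?X ?X []"
    using zigzag_append[OF zf zb] loc_eq.fwd_bwd[OF assms(3) s]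
    by (simp add: loc_class_eq_iff del: zigzag.simps)
  moreover have "loc_class C S ?Y ?Y [Bwd s, Fwd s] = loc_class C S ?Y ?Y []"
    using zigzag_append[OF zb zf] loc_eq.bwd_fwd[OF assms(3) s]
    by (simp add: loc_class_eq_iff del: zigzag.simps)
  moreover have "loc_class C S ?X ?Y [Fwd s] \<in> Mor (localization C S)"
    using zf by (auto simp: localization_def simp del: zigzag.simps)
  ultimately show ?thesis
    unfolding is_iso_def Q dc idt localization_Hom
    using localization_comp[OF zf zb] localization_comp[OF zb zf] zb
    by (intro conjI bexI[of _ "loc_class C S ?Y ?X [Bwd s]"])
       (auto simp del: zigzag.simps)
qed


section \<open>Additive and triangulated categories\<close>

record ('o, 'm) tri_data = "('o, 'm) cat_data" +
  Add :: "'m \<Rightarrow> 'm \<Rightarrow> 'm"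
  Zero :: "'o \<Rightarrow> 'o \<Rightarrow> 'm"
  Shift :: "('o, 'm, 'o, 'm) func"
  Dist :: "('m \<times> 'm \<times> 'm) set"

definition hom_group :: "('o, 'm, 'x) tri_data_scheme \<Rightarrow> 'o \<Rightarrow> 'o \<Rightarrow> 'm monoid" where
  "hom_group C X Y = \<lparr>carrier = Hom C X Y, monoid.mult = Add C, one = Zero C X Y\<rparr>"

definition neg :: "('o, 'm, 'x) tri_data_scheme \<Rightarrow> 'm \<Rightarrow> 'm" where
  "neg C f = inv\<^bsub>hom_group C (Dom C f) (Cod C f)\<^esub> f"

definition is_direct_sum :: "('o, 'm, 'x) tri_data_scheme \<Rightarrow> 'o \<Rightarrow> 'o \<Rightarrow> 'o \<Rightarrow> bool" where
  "is_direct_sum C X Y S \<longleftrightarrow> S \<in> Obj C \<and>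
     (\<exists>i1 \<in> Hom C X S. \<exists>i2 \<in> Hom C Y S. \<exists>p1 \<in> Hom C S X. \<exists>p2 \<in> Hom C S Y.
        Comp C p1 i1 = Idt C X \<and> Comp C p2 i2 = Idt C Y \<and>
        Comp C p2 i1 = Zero C X Y \<and> Comp C p1 i2 = Zero C Y X \<and>
        Add C (Comp C i1 p1) (Comp C i2 p2) = Idt C S)"

locale additive_category = category C
  for C :: "('o, 'm, 'x) tri_data_scheme" (structure) +
  assumes hom_comm_group: "\<lbrakk>X \<in> Obj C; Y \<in> Obj C\<rbrakk> \<Longrightarrow> comm_group (hom_group C X Y)"
    and comp_add_right: "\<lbrakk>f \<in> Hom C X Y; g \<in> Hom C X Y; h \<in> Hom C Y Z\<rbrakk>
        \<Longrightarrow> h \<cdot> (Add C f g) = Add C (h \<cdot> f) (h \<cdot> g)"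
    and comp_add_left: "\<lbrakk>h \<in> Hom C X Y; f \<in> Hom C Y Z; g \<in> Hom C Y Z\<rbrakk>
        \<Longrightarrow> (Add C f g) \<cdot> h = Add C (f \<cdot> h) (g \<cdot> h)"
    and zero_object_exists: "\<exists>Z. zero_object C Z"
    and direct_sum_exists: "\<lbrakk>X \<in> Obj C; Y \<in> Obj C\<rbrakk> \<Longrightarrow> \<exists>S. is_direct_sum C X Y S"

definition additive_functor ::
    "('o1, 'm1, 'x) tri_data_scheme \<Rightarrow> ('o2, 'm2, 'y) tri_data_scheme
      \<Rightarrow> ('o1, 'm1, 'o2, 'm2) func \<Rightarrow> bool" where
  "additive_functor C D F \<longleftrightarrow> is_functor C D F \<and>
     (\<forall>X \<in> Obj C. \<forall>Y \<in> Obj C. \<forall>f \<in> Hom C X Y. \<forall>g \<in> Hom C X Y.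
        Fmor F (Add C f g) = Add D (Fmor F f) (Fmor F g))"

abbreviation shift_ob :: "('o, 'm, 'x) tri_data_scheme \<Rightarrow> 'o \<Rightarrow> 'o" where
  "shift_ob C \<equiv> Fob (Shift C)"

abbreviation shift_mor :: "('o, 'm, 'x) tri_data_scheme \<Rightarrow> 'm \<Rightarrow> 'm" where
  "shift_mor C \<equiv> Fmor (Shift C)"

definition unshift_ob :: "('o, 'm, 'x) tri_data_scheme \<Rightarrow> 'o \<Rightarrow> 'o" where
  "unshift_ob C = inv_into (Obj C) (shift_ob C)"

text \<open>The triangle \<open>X \<rightarrow> Y \<rightarrow> Z \<rightarrow> X[1]\<close>.\<close>

definition triangle ::
    "('o, 'm, 'x) tri_data_scheme \<Rightarrow> 'o \<Rightarrow> 'o \<Rightarrow> 'o \<Rightarrow> 'm \<times> 'm \<times> 'm \<Rightarrow> bool" where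
  "triangle C X Y Z = (\<lambda>(f, g, h).
     X \<in> Obj C \<and> Y \<in> Obj C \<and> Z \<in> Obj C \<and>
     f \<in> Hom C X Y \<and> g \<in> Hom C Y Z \<and> h \<in> Hom C Z (shift_ob C X))"

definition dist_triangle ::
    "('o, 'm, 'x) tri_data_scheme \<Rightarrow> 'o \<Rightarrow> 'o \<Rightarrow> 'o \<Rightarrow> 'm \<times> 'm \<times> 'm \<Rightarrow> bool" where
  "dist_triangle C X Y Z t \<longleftrightarrow> triangle C X Y Z t \<and> t \<in> Dist C"

text \<open>Verdier's axioms; the shift is an automorphism of the category.\<close>

locale triangulated_category = additive_category C
  for C :: "('o, 'm, 'x) tri_data_scheme" (structure) +
  assumes shift_additive: "additive_functor C C (Shift C)"
    and shift_bij_ob: "bij_betw (shift_ob C) (Obj C) (Obj C)"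
    and shift_bij_mor: "bij_betw (shift_mor C) (Mor C) (Mor C)"
    and dist_is_triangle: "t \<in> Dist C \<Longrightarrow> \<exists>X Y Z. triangle C X Y Z t"
    and dist_iso: "\<lbrakk>dist_triangle C X Y Z (f, g, h); triangle C X' Y' Z' (f', g', h');
          a \<in> Hom C X X'; b \<in> Hom C Y Y'; c \<in> Hom C Z Z';
          is_iso C a; is_iso C b; is_iso C c;
          b \<cdot> f = f' \<cdot> a; c \<cdot> g = g' \<cdot> b; shift_mor C a \<cdot> h = h' \<cdot> c\<rbrakk>
        \<Longrightarrow> dist_triangle C X' Y' Z' (f', g', h')"
    and dist_idt: "\<lbrakk>X \<in> Obj C; zero_object C Z\<rbrakk>
        \<Longrightarrow> dist_triangle C X X Z (Idt C X, Zero C X Z, Zero C Z (shift_ob C X))"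
    and dist_complete: "f \<in> Hom C X Y \<Longrightarrow> \<exists>Z g h. dist_triangle C X Y Z (f, g, h)"
    and dist_rotate: "triangle C X Y Z (f, g, h) \<Longrightarrow>
        dist_triangle C X Y Z (f, g, h) \<longleftrightarrow>
        dist_triangle C Y Z (shift_ob C X) (g, h, neg C (shift_mor C f))"
    and dist_morphism: "\<lbrakk>dist_triangle C X Y Z (f, g, h); dist_triangle C X' Y' Z' (f', g', h');
          a \<in> Hom C X X'; b \<in> Hom C Y Y'; b \<cdot> f = f' \<cdot> a\<rbrakk>
        \<Longrightarrow> \<exists>c \<in> Hom C Z Z'. c \<cdot> g = g' \<cdot> b \<and> shift_mor C a \<cdot> h = h' \<cdot> c"
    and octahedron: "\<lbrakk>dist_triangle C X Y Z' (f, f', f'');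
          dist_triangle C Y Z X' (g, g', g'');
          dist_triangle C X Z Y' (g \<cdot> f, k', k'')\<rbrakk>
        \<Longrightarrow> \<exists>u v. dist_triangle C Z' Y' X' (u, v, shift_mor C f' \<cdot> g'') \<and>
              u \<cdot> f' = k' \<cdot> g \<and> v \<cdot> k' = g' \<and>
              k'' \<cdot> u = f'' \<and> g'' \<cdot> v = shift_mor C f \<cdot> k''"

definition exact_functor ::
    "('o1, 'm1, 'x) tri_data_scheme \<Rightarrow> ('o2, 'm2, 'y) tri_data_scheme
      \<Rightarrow> ('o1, 'm1, 'o2, 'm2) func \<Rightarrow> bool" where
  "exact_functor C D F \<longleftrightarrow> additive_functor C D F \<and>
     (\<exists>\<phi>. nat_iso C D (F \<circ>\<^sub>F Shift C) (Shift D \<circ>\<^sub>F F) \<phi> \<and>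
        (\<forall>X Y Z f g h. dist_triangle C X Y Z (f, g, h) \<longrightarrow>
           dist_triangle D (Fob F X) (Fob F Y) (Fob F Z)
             (Fmor F f, Fmor F g, Comp D (\<phi> X) (Fmor F h))))"

text \<open>The morphisms with a cone in \<open>N\<close>. Verdier's localization of \<open>C\<close> by \<open>N\<close> is
  \<^term>\<open>localization C (cone_in C N)\<close>. Cones are determined up to isomorphism only, so
  replacing \<open>N\<close> by its closure under isomorphism does not change this class.\<close>

definition cone_in :: "('o, 'm, 'x) tri_data_scheme \<Rightarrow> 'o set \<Rightarrow> 'm set" where
  "cone_in C N = {f. \<exists>X Y. \<exists>Z \<in> N. \<exists>g h. dist_triangle C X Y Z (f, g, h)}"

text \<open>\<open>F\<close> agrees with the localization functor of \<open>C\<close> by \<open>N\<close>, up to an equivalence of the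
  target. No exactness is asked of the equivalence: an exact \<open>F\<close> sends the distinguished
  triangles of \<open>C\<close>, whose images generate those of the localization, to distinguished ones.\<close>

definition is_localization_functor ::
    "('o1, 'm1, 'x) tri_data_scheme \<Rightarrow> ('o2, 'm2, 'y) tri_data_scheme
      \<Rightarrow> 'o1 set \<Rightarrow> ('o1, 'm1, 'o2, 'm2) func \<Rightarrow> bool" where
  "is_localization_functor C E N F \<longleftrightarrow>
     (\<exists>G. is_equivalence (localization C (cone_in C N)) E G \<and>
        (\<exists>\<tau>. nat_iso C E (G \<circ>\<^sub>F localization_functor C (cone_in C N)) F \<tau>))"


section \<open>Weight structures\<close>

locale weight_structure = triangulated_category C
  for C :: "('o, 'm, 'x) tri_data_scheme" (structure)
    and le :: "'o set" and ge :: "'o set" +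
  assumes le_sub: "le \<subseteq> Obj C"
    and ge_sub: "ge \<subseteq> Obj C"
    and le_zero: "\<exists>Z \<in> le. zero_object C Z"
    and ge_zero: "\<exists>Z \<in> ge. zero_object C Z"
    and le_direct_sum: "\<lbrakk>X \<in> le; Y \<in> le\<rbrakk> \<Longrightarrow> \<exists>S \<in> le. is_direct_sum C X Y S"
    and ge_direct_sum: "\<lbrakk>X \<in> ge; Y \<in> ge\<rbrakk> \<Longrightarrow> \<exists>S \<in> ge. is_direct_sum C X Y S"
    and le_retract: "\<lbrakk>Y \<in> le; X \<in> Obj C; is_retract C X Y\<rbrakk> \<Longrightarrow> X \<in> le"
    and ge_retract: "\<lbrakk>Y \<in> ge; X \<in> Obj C; is_retract C X Y\<rbrakk> \<Longrightarrow> X \<in> ge"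
    and ge_shift: "ge \<subseteq> shift_ob C ` ge"
    and le_shift: "shift_ob C ` le \<subseteq> le"
    and orthogonal: "\<lbrakk>X \<in> ge; Y \<in> shift_ob C ` le\<rbrakk> \<Longrightarrow> Hom C X Y = {Zero C X Y}"
    and decomposition: "X \<in> Obj C
        \<Longrightarrow> \<exists>A \<in> le. \<exists>B \<in> ge. \<exists>f g h. dist_triangle C (unshift_ob C B) X A (f, g, h)"


section \<open>Gluing data and the six functors\<close>

text \<open>Naming of the six functors: \<open>l\<close>/\<open>u\<close> for a lower/upper decoration, \<open>st\<close>/\<open>sh\<close> for
  star/shriek. In the order of the arguments they are \<open>i\<^sub>*\<close>, \<open>j\<^sup>*\<close>, \<open>i\<^sup>*\<close>, \<open>i\<^sup>!\<close>, \<open>j\<^sub>!\<close>, \<open>j\<^sub>*\<close>.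
  The units and counits belong to, in this order, \<open>i\<^sup>* \<stileturn> i\<^sub>*\<close>, \<open>i\<^sub>* \<stileturn> i\<^sup>!\<close>, \<open>j\<^sub>! \<stileturn> j\<^sup>*\<close>, \<open>j\<^sup>* \<stileturn> j\<^sub>*\<close>.\<close>

definition gluing_data ::
    "('oc, 'mc, 'x) tri_data_scheme \<Rightarrow> ('od, 'md, 'y) tri_data_scheme
      \<Rightarrow> ('oe, 'me, 'z) tri_data_scheme
      \<Rightarrow> ('od, 'md, 'oc, 'mc) func \<Rightarrow> ('oc, 'mc, 'oe, 'me) func
      \<Rightarrow> ('oc, 'mc, 'od, 'md) func \<Rightarrow> ('oc, 'mc, 'od, 'md) func
      \<Rightarrow> ('oe, 'me, 'oc, 'mc) func \<Rightarrow> ('oe, 'me, 'oc, 'mc) func \<Rightarrow> bool" where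
  "gluing_data C D E i_lst j_ust i_ust i_ush j_lsh j_lst \<longleftrightarrow>
     triangulated_category C \<and> triangulated_category D \<and> triangulated_category E \<and>
     exact_functor D C i_lst \<and> exact_functor C E j_ust \<and>
     exact_functor C D i_ust \<and> exact_functor C D i_ush \<and>
     exact_functor E C j_lsh \<and> exact_functor E C j_lst \<and>
     fully_faithful D C i_lst \<and>
     is_localization_functor C E (Fob i_lst ` Obj D) j_ust \<and>
     (\<exists>\<eta>1 \<epsilon>1 \<eta>2 \<epsilon>2 \<eta>3 \<epsilon>3 \<eta>4 \<epsilon>4.
        adjunction C D i_ust i_lst \<eta>1 \<epsilon>1 \<and>
        adjunction D C i_lst i_ush \<eta>2 \<epsilon>2 \<and>
        adjunction E C j_lsh j_ust \<eta>3 \<epsilon>3 \<and>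
        adjunction C E j_ust j_lst \<eta>4 \<epsilon>4 \<and>
        (\<forall>X \<in> Obj C.
           (\<exists>h. dist_triangle C (Fob j_lsh (Fob j_ust X)) X (Fob i_lst (Fob i_ust X))
                  (\<epsilon>3 X, \<eta>1 X, h)) \<and>
           (\<exists>h. dist_triangle C (Fob i_lst (Fob i_ush X)) X (Fob j_lst (Fob j_ust X))
                  (\<epsilon>2 X, \<eta>4 X, h))) \<and>
        nat_iso D D (i_ust \<circ>\<^sub>F i_lst) func_id \<epsilon>1 \<and>
        nat_iso D D func_id (i_ush \<circ>\<^sub>F i_lst) \<eta>2 \<and>
        nat_iso E E (j_ust \<circ>\<^sub>F j_lst) func_id \<epsilon>4 \<and>
        nat_iso E E func_id (j_ust \<circ>\<^sub>F j_lsh) \<eta>3) \<and>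
     (\<forall>X \<in> Obj E. zero_object D (Fob i_ust (Fob j_lsh X))) \<and>
     (\<forall>X \<in> Obj E. zero_object D (Fob i_ush (Fob j_lst X)))"

end

theory Submission
  imports Defs
begin

text \<open>All classes involved are closed under retracts, so retracts replace isomorphisms throughout.
  Orthogonality: in \<open>j\<^sub>!j\<^sup>*X \<rightarrow> X \<rightarrow> i\<^sub>*i\<^sup>*X\<close> both outer terms have no nonzero maps to \<open>Y\<close>, by
  adjunction and orthogonality in \<open>\<E>\<close> and \<open>\<D>\<close>. Decomposition: decompose \<open>j\<^sup>*X\<close> and transpose
  \<open>j\<^sup>*X \<rightarrow> P\<close> to get \<open>Y \<rightarrow> X \<rightarrow> j\<^sub>*P\<close>; then decompose \<open>i\<^sup>*Y\<close> to get \<open>W \<rightarrow> Y \<rightarrow> i\<^sub>*Q\<close>. The cone \<open>A\<close> of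
  the composite \<open>W \<rightarrow> X\<close> lies in a triangle \<open>i\<^sub>*Q \<rightarrow> A \<rightarrow> j\<^sub>*P\<close> by the octahedral axiom, so
  \<open>i\<^sup>!A\<close> is \<open>Q\<close> and \<open>j\<^sup>*A\<close> is \<open>P\<close>; and \<open>W[1]\<close> is the other part, since \<open>j\<^sup>*W\<close> is \<open>j\<^sup>*Y\<close>.
  The vanishing \<open>j\<^sup>*i\<^sub>* = 0\<close> comes from \<open>i\<^sup>*j\<^sub>! = 0\<close> by two adjunctions.\<close>

section \<open>Retracts, isomorphisms and zero objects in a category\<close>

context category
begin

lemma HomD:
  assumes "f \<in> Hom C X Y"
  shows "f \<in> Mor C" "Dom C f = X" "Cod C f = Y" "X \<in> Obj C" "Y \<in> Obj C"
  using assms dom_in cod_in by (auto simp: Hom_def)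

lemma iso_inverseE:
  assumes "is_iso C f" "f \<in> Hom C X Y"
  obtains g where "g \<in> Hom C Y X" "g \<cdot> f = Idt C X" "f \<cdot> g = Idt C Y"
  using assms by (auto simp: is_iso_def Hom_def)

lemma iso_imp_retract:
  assumes "is_iso C f" "f \<in> Hom C X Y"
  shows "is_retract C X Y" "is_retract C Y X"
  using iso_inverseE[OF assms] assms(2) unfolding is_retract_def by metis+

lemma retract_trans:
  assumes "is_retract C X Y" "is_retract C Y Z"
  shows "is_retract C X Z"
proof -
  obtain s r s' r' where
    *: "s \<in> Hom C X Y" "r \<in> Hom C Y X" "r \<cdot> s = Idt C X"
      "s' \<in> Hom C Y Z" "r' \<in> Hom C Z Y" "r' \<cdot> s' = Idt C Y"
    using assms unfolding is_retract_def by blast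
  have "(r \<cdot> r') \<cdot> (s' \<cdot> s) = r \<cdot> (r' \<cdot> (s' \<cdot> s))"
    using comp_assoc[OF *(1,4) comp_in[OF *(5,2)]] comp_assoc[OF *(1,4,5)]
      comp_assoc[OF *(4,5,2)] comp_assoc[OF *(1) comp_in[OF *(4,5)] *(2)] by simp
  also have "\<dots> = Idt C X"
    using *(3,6) comp_assoc[OF *(1,4,5)] comp_idt_left[OF *(1)] by simp
  finally show ?thesis
    using comp_in[OF *(1,4)] comp_in[OF *(5,2)] unfolding is_retract_def by blast
qed

lemma zero_objectD:
  assumes "zero_object C Z" "X \<in> Obj C"
  shows "\<lbrakk>f \<in> Hom C X Z; g \<in> Hom C X Z\<rbrakk> \<Longrightarrow> f = g"
    and "\<lbrakk>f \<in> Hom C Z X; g \<in> Hom C Z X\<rbrakk> \<Longrightarrow> f = g"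
  using assms unfolding zero_object_def by blast+

end


section \<open>Arithmetic of hom-groups, zero objects and direct sums\<close>

context additive_category
begin

lemma hom_group_simps:
  "carrier (hom_group C X Y) = Hom C X Y"
  "monoid.mult (hom_group C X Y) f g = Add C f g"
  "one (hom_group C X Y) = Zero C X Y"
  by (simp_all add: hom_group_def)

lemma
  assumes "X \<in> Obj C" "Y \<in> Obj C"
  shows zero_in: "Zero C X Y \<in> Hom C X Y"
    and add_in: "\<lbrakk>f \<in> Hom C X Y; g \<in> Hom C X Y\<rbrakk> \<Longrightarrow> Add C f g \<in> Hom C X Y"
    and add_zero_right: "f \<in> Hom C X Y \<Longrightarrow> Add C f (Zero C X Y) = f"
    and add_zero_left: "f \<in> Hom C X Y \<Longrightarrow> Add C (Zero C X Y) f = f"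
    and add_assoc: "\<lbrakk>f \<in> Hom C X Y; g \<in> Hom C X Y; h \<in> Hom C X Y\<rbrakk>
      \<Longrightarrow> Add C (Add C f g) h = Add C f (Add C g h)"
    and add_idem_imp_zero: "\<lbrakk>f \<in> Hom C X Y; Add C f f = f\<rbrakk> \<Longrightarrow> f = Zero C X Y"
    and neg_in: "f \<in> Hom C X Y \<Longrightarrow> neg C f \<in> Hom C X Y"
    and add_neg_right: "f \<in> Hom C X Y \<Longrightarrow> Add C f (neg C f) = Zero C X Y"
    and add_neg_left: "f \<in> Hom C X Y \<Longrightarrow> Add C (neg C f) f = Zero C X Y"
    and neg_unique: "\<lbrakk>f \<in> Hom C X Y; g \<in> Hom C X Y; Add C f g = Zero C X Y\<rbrakk> \<Longrightarrow> g = neg C f"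
proof -
  interpret G: comm_group "hom_group C X Y" by (rule hom_comm_group[OF assms])
  note G = G.one_closed G.m_closed G.r_one G.l_one G.m_assoc G.inv_closed G.r_inv G.l_inv
  note G = G[unfolded hom_group_simps]
  \<comment> \<open>\<open>neg\<close> reads the hom-group off the domain and codomain of its
    argument, so it is the inverse in the group of maps from \<open>X\<close> to \<open>Y\<close>
    only once \<open>f\<close> is known to lie there.\<close>
  have neg: "neg C f = inv\<^bsub>hom_group C X Y\<^esub> f" if "f \<in> Hom C X Y" for f
    using that by (simp add: neg_def Hom_def)
  show "Zero C X Y \<in> Hom C X Y" by (rule G)
  show "\<lbrakk>f \<in> Hom C X Y; g \<in> Hom C X Y\<rbrakk> \<Longrightarrow> Add C f g \<in> Hom C X Y" by (rule G)
  show "f \<in> Hom C X Y \<Longrightarrow> Add C f (Zero C X Y) = f" by (rule G)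
  show "f \<in> Hom C X Y \<Longrightarrow> Add C (Zero C X Y) f = f" by (rule G)
  show "\<lbrakk>f \<in> Hom C X Y; g \<in> Hom C X Y; h \<in> Hom C X Y\<rbrakk>
      \<Longrightarrow> Add C (Add C f g) h = Add C f (Add C g h)" by (rule G)
  show "\<lbrakk>f \<in> Hom C X Y; Add C f f = f\<rbrakk> \<Longrightarrow> f = Zero C X Y"
    using G.r_cancel_one[unfolded hom_group_simps] by metis
  show "f \<in> Hom C X Y \<Longrightarrow> neg C f \<in> Hom C X Y" using neg G(6) by metis
  show "f \<in> Hom C X Y \<Longrightarrow> Add C f (neg C f) = Zero C X Y" using neg G(7) by metis
  show "f \<in> Hom C X Y \<Longrightarrow> Add C (neg C f) f = Zero C X Y" using neg G(8) by metis
  show "\<lbrakk>f \<in> Hom C X Y; g \<in> Hom C X Y; Add C f g = Zero C X Y\<rbrakk> \<Longrightarrow> g = neg C f"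
    using neg G.inv_equality[unfolded hom_group_simps] G.m_comm[unfolded hom_group_simps]
    by metis
qed

lemma neg_neg:
  assumes "f \<in> Hom C X Y"
  shows "neg C (neg C f) = f"
  using neg_unique[of X Y "neg C f" f] assms HomD[OF assms] neg_in add_neg_left by simp

text \<open>By bilinearity the composite is its own double, and in a group only zero has this
  property.\<close>

lemma comp_zero_right:
  assumes "h \<in> Hom C Y Z" "X \<in> Obj C"
  shows "h \<cdot> Zero C X Y = Zero C X Z"
proof -
  note Y = HomD(4,5)[OF assms(1)]
  note z = zero_in[OF assms(2) Y(1)]
  show ?thesis
    using add_idem_imp_zero[OF assms(2) Y(2) comp_in[OF z assms(1)]]
      comp_add_right[OF z z assms(1)] add_zero_left[OF assms(2) Y(1) z] by simp
qed

lemma comp_zero_left: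
  assumes "h \<in> Hom C X Y" "Z \<in> Obj C"
  shows "Zero C Y Z \<cdot> h = Zero C X Z"
proof -
  note X = HomD(4,5)[OF assms(1)]
  note z = zero_in[OF X(2) assms(2)]
  show ?thesis
    using add_idem_imp_zero[OF X(1) assms(2) comp_in[OF assms(1) z]]
      comp_add_left[OF assms(1) z z] add_zero_left[OF X(2) assms(2) z] by simp
qed

lemma comp_neg_right:
  assumes "f \<in> Hom C X Y" "h \<in> Hom C Y Z"
  shows "h \<cdot> neg C f = neg C (h \<cdot> f)"
proof -
  note X = HomD(4,5)[OF assms(1)] and Z = HomD(5)[OF assms(2)]
  note n = neg_in[OF X assms(1)]
  show ?thesis
    using neg_unique[OF X(1) Z comp_in[OF assms] comp_in[OF n assms(2)]]
      comp_add_right[OF assms(1) n assms(2)] add_neg_right[OF X assms(1)]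
      comp_zero_right[OF assms(2) X(1)] by simp
qed

lemma comp_neg_left:
  assumes "h \<in> Hom C X Y" "f \<in> Hom C Y Z"
  shows "neg C f \<cdot> h = neg C (f \<cdot> h)"
proof -
  note X = HomD(4)[OF assms(1)] and Y = HomD(4,5)[OF assms(2)]
  note n = neg_in[OF Y assms(2)]
  show ?thesis
    using neg_unique[OF X Y(2) comp_in[OF assms] comp_in[OF assms(1) n]]
      comp_add_left[OF assms(1,2) n] add_neg_right[OF Y assms(2)]
      comp_zero_left[OF assms(1) Y(2)] by simp
qed

text \<open>Every map into or out of \<open>Z\<close> factors through \<open>Idt C Z\<close>. The
  criterion is a single equation, so additive functors transport it.\<close>

lemma zero_objectI:
  assumes "Z \<in> Obj C" "Idt C Z = Zero C Z Z"
  shows "zero_object C Z"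
  unfolding zero_object_def
proof (intro conjI ballI ex1I)
  fix X f assume "X \<in> Obj C" "f \<in> Hom C X Z"
  then show "f = Zero C X Z" using assms comp_idt_left comp_zero_left by metis
next
  fix X f assume "X \<in> Obj C" "f \<in> Hom C Z X"
  then show "f = Zero C Z X" using assms comp_idt_right comp_zero_right by metis
qed (use assms zero_in in auto)

lemma zero_object_idt:
  assumes "zero_object C Z"
  shows "Idt C Z = Zero C Z Z"
  using assms idt_in zero_in zero_objectD(1) unfolding zero_object_def by metis

lemma zero_object_retract:
  assumes "zero_object C X" "zero_object C Y"
  shows "is_retract C X Y"
proof -
  have X: "X \<in> Obj C" and Y: "Y \<in> Obj C" using assms by (auto simp: zero_object_def)
  note z = zero_in[OF X Y] zero_in[OF Y X]
  have "Zero C Y X \<cdot> Zero C X Y = Idt C X"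
    using zero_objectD(1)[OF assms(1) X comp_in[OF z] idt_in[OF X]] .
  then show ?thesis using z unfolding is_retract_def by blast
qed

text \<open>The axioms of a weight structure put some direct sum into each class. With closure under
  retracts, this comparison puts every direct sum there.\<close>

lemma direct_sum_retract:
  assumes "is_direct_sum C X Y S" "is_direct_sum C X Y T" "X \<in> Obj C" "Y \<in> Obj C"
  shows "is_retract C S T"
proof -
  obtain i1 i2 p1 p2 where S: "S \<in> Obj C"
    "i1 \<in> Hom C X S" "i2 \<in> Hom C Y S" "p1 \<in> Hom C S X" "p2 \<in> Hom C S Y"
    "Add C (i1 \<cdot> p1) (i2 \<cdot> p2) = Idt C S"
    using assms(1) unfolding is_direct_sum_def by blast
  obtain j1 j2 q1 q2 where T: "T \<in> Obj C"
    "j1 \<in> Hom C X T" "j2 \<in> Hom C Y T" "q1 \<in> Hom C T X" "q2 \<in> Hom C T Y"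
    "q1 \<cdot> j1 = Idt C X" "q2 \<cdot> j2 = Idt C Y" "q2 \<cdot> j1 = Zero C X Y" "q1 \<cdot> j2 = Zero C Y X"
    using assms(2) unfolding is_direct_sum_def by blast
  \<comment> \<open>\<open>s\<close> and \<open>r\<close> match the summands of \<open>S\<close> and
    \<open>T\<close>. Once \<open>q1 \<cdot> s = p1\<close> and \<open>q2 \<cdot> s = p2\<close> are
    known, \<open>r \<cdot> s\<close> becomes the decomposition of the identity of
    \<open>S\<close>.\<close>
  define s where "s = Add C (j1 \<cdot> p1) (j2 \<cdot> p2)"
  define r where "r = Add C (i1 \<cdot> q1) (i2 \<cdot> q2)"
  have h: "j1 \<cdot> p1 \<in> Hom C S T" "j2 \<cdot> p2 \<in> Hom C S T" "i1 \<cdot> q1 \<in> Hom C T S" "i2 \<cdot> q2 \<in> Hom C T S"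
    "i1 \<cdot> p1 \<in> Hom C S S" "i2 \<cdot> p2 \<in> Hom C S S"
    using comp_in[OF S(4) T(2)] comp_in[OF S(5) T(3)] comp_in[OF T(4) S(2)]
      comp_in[OF T(5) S(3)] comp_in[OF S(4,2)] comp_in[OF S(5,3)] .
  have s: "s \<in> Hom C S T" and r: "r \<in> Hom C T S"
    unfolding s_def r_def using h S(1) T(1) by (simp_all add: add_in)
  have q1: "q1 \<cdot> s = p1"
    unfolding s_def using comp_add_right[OF h(1,2) T(4)]
      comp_assoc[OF S(4) T(2,4)] comp_assoc[OF S(5) T(3,4)] T(6,9) comp_idt_left[OF S(4)]
      comp_zero_left[OF S(5) assms(3)] add_zero_right[OF S(1) assms(3) S(4)] by simp
  have q2: "q2 \<cdot> s = p2"
    unfolding s_def using comp_add_right[OF h(1,2) T(5)]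
      comp_assoc[OF S(4) T(2,5)] comp_assoc[OF S(5) T(3,5)] T(7,8) comp_idt_left[OF S(5)]
      comp_zero_left[OF S(4) assms(4)] add_zero_left[OF S(1) assms(4) S(5)] by simp
  have "r \<cdot> s = Add C ((i1 \<cdot> q1) \<cdot> s) ((i2 \<cdot> q2) \<cdot> s)"
    using comp_add_left[OF s h(3,4)] by (simp add: r_def)
  also have "\<dots> = Add C (i1 \<cdot> (q1 \<cdot> s)) (i2 \<cdot> (q2 \<cdot> s))"
    using comp_assoc[OF s T(4) S(2)] comp_assoc[OF s T(5) S(3)] by simp
  also have "\<dots> = Idt C S" using q1 q2 S by simp
  finally show ?thesis using r s unfolding is_retract_def by blast
qed

end

section \<open>Functors and additive functors\<close>

lemma
  assumes "category C" "is_functor C D F"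
  shows functor_ob: "X \<in> Obj C \<Longrightarrow> Fob F X \<in> Obj D"
    and functor_mor: "f \<in> Hom C X Y \<Longrightarrow> Fmor F f \<in> Hom D (Fob F X) (Fob F Y)"
    and functor_idt: "X \<in> Obj C \<Longrightarrow> Fmor F (Idt C X) = Idt D (Fob F X)"
    and functor_comp: "\<lbrakk>f \<in> Hom C X Y; g \<in> Hom C Y Z\<rbrakk>
      \<Longrightarrow> Fmor F (Comp C g f) = Comp D (Fmor F g) (Fmor F f)"
proof -
  interpret category C by fact
  note F = assms(2)[unfolded is_functor_def]
  show "Fob F X \<in> Obj D" if "X \<in> Obj C" using F that by blast
  show "Fmor F f \<in> Hom D (Fob F X) (Fob F Y)" if "f \<in> Hom C X Y"
    using F that HomD(4,5)[OF that] by blast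
  show "Fmor F (Idt C X) = Idt D (Fob F X)" if "X \<in> Obj C" using F that by blast
  show "Fmor F (Comp C g f) = Comp D (Fmor F g) (Fmor F f)"
    if "f \<in> Hom C X Y" "g \<in> Hom C Y Z"
    using F that HomD(4,5)[OF that(1)] HomD(5)[OF that(2)] by blast
qed

lemma functor_retract:
  assumes "category C" "is_functor C D F" "is_retract C X Y"
  shows "is_retract D (Fob F X) (Fob F Y)"
proof -
  interpret category C by fact
  obtain s r where *: "s \<in> Hom C X Y" "r \<in> Hom C Y X" "Comp C r s = Idt C X"
    using assms(3) unfolding is_retract_def by blast
  show ?thesis unfolding is_retract_def
    using * functor_mor[OF assms(1,2)] functor_comp[OF assms(1,2) *(1,2)]
      functor_idt[OF assms(1,2)] HomD(4)[OF *(1)] by metis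
qed

locale additive_functor_between = C: additive_category C + D: additive_category D
  for C :: "('oc, 'mc, 'x) tri_data_scheme" and D :: "('od, 'md, 'y) tri_data_scheme"
    and F :: "('oc, 'mc, 'od, 'md) func" +
  assumes additive: "additive_functor C D F"
begin

lemma is_functor: "is_functor C D F"
  using additive unfolding additive_functor_def by blast

lemmas ob = functor_ob[OF C.category_axioms is_functor]
lemmas mor = functor_mor[OF C.category_axioms is_functor]
lemmas idt = functor_idt[OF C.category_axioms is_functor]
lemmas comp = functor_comp[OF C.category_axioms is_functor]
lemmas retract = functor_retract[OF C.category_axioms is_functor]

lemma add:
  assumes "f \<in> Hom C X Y" "g \<in> Hom C X Y"
  shows "Fmor F (Add C f g) = Add D (Fmor F f) (Fmor F g)"
  using additive assms C.HomD[OF assms(1)] unfolding additive_functor_def by blast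

lemma zero:
  assumes "X \<in> Obj C" "Y \<in> Obj C"
  shows "Fmor F (Zero C X Y) = Zero D (Fob F X) (Fob F Y)"
  using D.add_idem_imp_zero[OF ob ob mor, OF assms C.zero_in[OF assms]]
    add[OF C.zero_in C.zero_in, OF assms assms] C.add_zero_left[OF assms C.zero_in[OF assms]]
  by simp

lemma zero_object:
  assumes "zero_object C Z"
  shows "zero_object D (Fob F Z)"
proof (rule D.zero_objectI)
  have Z: "Z \<in> Obj C" using assms by (simp add: zero_object_def)
  then show "Fob F Z \<in> Obj D" by (rule ob)
  show "Idt D (Fob F Z) = Zero D (Fob F Z) (Fob F Z)"
    using C.zero_object_idt[OF assms] idt[OF Z] zero[OF Z Z] by simp
qed

lemma direct_sum:
  assumes "is_direct_sum C X Y S" "X \<in> Obj C" "Y \<in> Obj C"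
  shows "is_direct_sum D (Fob F X) (Fob F Y) (Fob F S)"
proof -
  obtain i1 i2 p1 p2 where S: "S \<in> Obj C"
    "i1 \<in> Hom C X S" "i2 \<in> Hom C Y S" "p1 \<in> Hom C S X" "p2 \<in> Hom C S Y"
    "Comp C p1 i1 = Idt C X" "Comp C p2 i2 = Idt C Y"
    "Comp C p2 i1 = Zero C X Y" "Comp C p1 i2 = Zero C Y X"
    "Add C (Comp C i1 p1) (Comp C i2 p2) = Idt C S"
    using assms(1) unfolding is_direct_sum_def by blast
  have "Add D (Fmor F (Comp C i1 p1)) (Fmor F (Comp C i2 p2)) = Idt D (Fob F S)"
    using S(10) add[OF C.comp_in[OF S(4,2)] C.comp_in[OF S(5,3)]] idt[OF S(1)] by simp
  then show ?thesis
    unfolding is_direct_sum_def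
    using S ob[OF S(1)] comp[OF S(2) S(4)] comp[OF S(4) S(2)] comp[OF S(3) S(5)]
      comp[OF S(5) S(3)] comp[OF S(2) S(5)] comp[OF S(3) S(4)]
      idt[OF assms(2)] idt[OF assms(3)] zero[OF assms(2,3)] zero[OF assms(3,2)]
    by (intro conjI bexI[of _ "Fmor F i1"] bexI[of _ "Fmor F i2"]
        bexI[of _ "Fmor F p1"] bexI[of _ "Fmor F p2"]) (simp_all add: mor)
qed

end


section \<open>The shift and distinguished triangles\<close>

context triangulated_category
begin

sublocale shift: additive_functor_between C C "Shift C"
  using shift_additive by unfold_locales

lemma shift_ob_inj:
  assumes "X \<in> Obj C" "Y \<in> Obj C" "shift_ob C X = shift_ob C Y"
  shows "X = Y"
  using assms shift_bij_ob unfolding bij_betw_def inj_on_def by blast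

lemma shift_mor_inj:
  assumes "f \<in> Hom C X Y" "g \<in> Hom C X Y" "shift_mor C f = shift_mor C g"
  shows "f = g"
  using assms HomD(1) shift_bij_mor unfolding bij_betw_def inj_on_def by blast

lemma shift_obE:
  assumes "X \<in> Obj C"
  obtains Y where "Y \<in> Obj C" "X = shift_ob C Y"
  using assms shift_bij_ob unfolding bij_betw_def by blast

text \<open>Bijectivity on all morphisms gives a preimage whose ends are not yet known; injectivity
  on objects identifies them as \<open>X\<close> and \<open>Y\<close>.\<close>

lemma shift_fullE:
  assumes "g \<in> Hom C (shift_ob C X) (shift_ob C Y)" "X \<in> Obj C" "Y \<in> Obj C"
  obtains f where "f \<in> Hom C X Y" "g = shift_mor C f"
proof -
  obtain f where f: "f \<in> Mor C" "g = shift_mor C f"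
    using HomD(1)[OF assms(1)] shift_bij_mor unfolding bij_betw_def by blast
  have "f \<in> Hom C (Dom C f) (Cod C f)" using f by (simp add: Hom_def)
  from shift.mor[OF this] have "shift_ob C (Dom C f) = shift_ob C X"
    "shift_ob C (Cod C f) = shift_ob C Y"
    using assms(1) f(2) by (auto simp: Hom_def)
  then have "Dom C f = X" "Cod C f = Y"
    using shift_ob_inj assms(2,3) f(1) dom_in cod_in by blast+
  with f that show ?thesis by (simp add: Hom_def)
qed

lemma unshift_shift: "X \<in> Obj C \<Longrightarrow> unshift_ob C (shift_ob C X) = X"
  using shift_bij_ob unfolding unshift_ob_def bij_betw_def by simp

lemma shift_unshift:
  assumes "X \<in> Obj C"
  shows "unshift_ob C X \<in> Obj C" "shift_ob C (unshift_ob C X) = X"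
  using assms unshift_shift by (metis shift_obE)+

text \<open>The shift is full and faithful, so section, retraction and the equation between them all
  descend.\<close>

lemma shift_retractD:
  assumes "is_retract C (shift_ob C X) (shift_ob C Y)" "X \<in> Obj C" "Y \<in> Obj C"
  shows "is_retract C X Y"
proof -
  obtain s r where *: "s \<in> Hom C (shift_ob C X) (shift_ob C Y)"
    "r \<in> Hom C (shift_ob C Y) (shift_ob C X)" "r \<cdot> s = Idt C (shift_ob C X)"
    using assms(1) unfolding is_retract_def by blast
  obtain s' where s': "s' \<in> Hom C X Y" "s = shift_mor C s'"
    using shift_fullE[OF *(1) assms(2,3)] .
  obtain r' where r': "r' \<in> Hom C Y X" "r = shift_mor C r'"
    using shift_fullE[OF *(2) assms(3,2)] .
  have "r' \<cdot> s' = Idt C X"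
    using *(3) s' r' shift.comp[OF s'(1) r'(1)] shift.idt[OF assms(2)] comp_in[OF s'(1) r'(1)]
      idt_in[OF assms(2)] shift_mor_inj by metis
  then show ?thesis using s' r' unfolding is_retract_def by blast
qed

lemma dist_triangleD:
  assumes "dist_triangle C X Y Z (f, g, h)"
  shows "f \<in> Hom C X Y" "g \<in> Hom C Y Z" "h \<in> Hom C Z (shift_ob C X)"
    "X \<in> Obj C" "Y \<in> Obj C" "Z \<in> Obj C"
  using assms unfolding dist_triangle_def triangle_def by auto

lemma dist_triangle_rotate:
  assumes "dist_triangle C X Y Z (f, g, h)"
  shows "dist_triangle C Y Z (shift_ob C X) (g, h, neg C (shift_mor C f))"
  using assms dist_rotate unfolding dist_triangle_def by blast

text \<open>The rotation axiom applies only when the third map has the form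
  \<open>neg C (shift_mor C f)\<close>. Fullness of the shift, applied to \<open>neg C k\<close>,
  supplies this \<open>f\<close>.\<close>

lemma dist_triangle_rotate_backE:
  assumes "dist_triangle C Y Z (shift_ob C X) (g, h, k)" "X \<in> Obj C"
  obtains f where "dist_triangle C X Y Z (f, g, h)" "k = neg C (shift_mor C f)"
proof -
  note t = dist_triangleD[OF assms(1)]
  obtain f where f: "f \<in> Hom C X Y" "neg C k = shift_mor C f"
    using shift_fullE[OF neg_in[OF t(6) shift.ob[OF t(4)] t(3)] assms(2) t(4)] .
  have k: "k = neg C (shift_mor C f)" using neg_neg[OF t(3)] f by simp
  have "triangle C X Y Z (f, g, h)"
    unfolding triangle_def using t f assms(2) by simp
  from dist_rotate[OF this] assms(1) k have "dist_triangle C X Y Z (f, g, h)" by simp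
  with k that show ?thesis by blast
qed

text \<open>The fibre of \<open>g\<close> is its cone desuspended, which exists because the shift is
  onto on objects.\<close>

lemma dist_triangle_second_exists:
  assumes "g \<in> Hom C Y Z"
  obtains X f h where "dist_triangle C X Y Z (f, g, h)"
proof -
  obtain K h k where K: "dist_triangle C Y Z K (g, h, k)" using dist_complete[OF assms] by blast
  obtain X where "X \<in> Obj C" "K = shift_ob C X" using shift_obE dist_triangleD(6)[OF K] by metis
  then show ?thesis using dist_triangle_rotate_backE K that by metis
qed

text \<open>Rotating the triangle of an identity map backwards needs a zero object that is the shift
  of a known object.\<close>

lemma zero_object_shiftE:
  obtains Z where "zero_object C Z" "zero_object C (shift_ob C Z)"
  using zero_object_exists shift.zero_object by blast

text \<open>Exactness of maps into \<open>T\<close>. The triangle is compared with one whose second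
  map is the identity of \<open>T\<close>: the zero map on first terms and \<open>b\<close> on
  second terms extend to third terms, and the extension is \<open>c\<close>.\<close>

lemma dist_triangle_factor:
  assumes t: "dist_triangle C X Y Z (f, g, h)" and b: "b \<in> Hom C Y T" "b \<cdot> f = Zero C X T"
  obtains c where "c \<in> Hom C Z T" "c \<cdot> g = b"
proof -
  note d = dist_triangleD[OF t]
  obtain O' where O': "zero_object C O'" "zero_object C (shift_ob C O')"
    by (rule zero_object_shiftE)
  have T: "T \<in> Obj C" and O: "O' \<in> Obj C" using HomD[OF b(1)] O' by (auto simp: zero_object_def)
  obtain z where z: "dist_triangle C O' T T (z, Idt C T, Zero C T (shift_ob C O'))"
    using dist_triangle_rotate_backE[OF dist_idt[OF T O'(2)] O] .
  have "b \<cdot> f = z \<cdot> Zero C X O'"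
    using b(2) comp_zero_right[OF dist_triangleD(1)[OF z] d(4)] by simp
  from dist_morphism[OF t z zero_in[OF d(4) O] b(1) this]
  obtain c where "c \<in> Hom C Z T" "c \<cdot> g = Idt C T \<cdot> b" by blast
  then show ?thesis using that comp_idt_left[OF b(1)] by simp
qed

text \<open>The identity of \<open>Y\<close> kills \<open>f\<close>, which starts at a zero object,
  so it factors through \<open>g\<close>.\<close>

lemma dist_triangle_zero_first:
  assumes t: "dist_triangle C X Y Z (f, g, h)" and X: "zero_object C X"
  shows "is_retract C Y Z"
proof -
  note d = dist_triangleD[OF t]
  have "Idt C Y \<cdot> f = Zero C X Y"
    using comp_idt_left[OF d(1)] zero_objectD(2)[OF X d(5) d(1) zero_in[OF d(4,5)]] by simp
  then obtain c where "c \<in> Hom C Z Y" "c \<cdot> g = Idt C Y"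
    using dist_triangle_factor[OF t idt_in[OF d(5)]] by blast
  then show ?thesis using d(2) unfolding is_retract_def by blast
qed

text \<open>Two rotations bring \<open>Z\<close> to the front, which gives the first retraction. The
  second needs a right inverse of the shifted \<open>f\<close>.\<close>

lemma dist_triangle_zero_third:
  assumes t: "dist_triangle C X Y Z (f, g, h)" and Z: "zero_object C Z"
  shows "is_retract C X Y" "is_retract C Y X"
proof -
  note d = dist_triangleD[OF t]
  note t' = dist_triangle_rotate[OF t]
  have "is_retract C (shift_ob C X) (shift_ob C Y)"
    using dist_triangle_zero_first[OF dist_triangle_rotate[OF t'] Z] .
  then show "is_retract C X Y" using shift_retractD d by blast
  have sf: "shift_mor C f \<in> Hom C (shift_ob C X) (shift_ob C Y)" by (rule shift.mor[OF d(1)])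
  have sY: "shift_ob C Y \<in> Obj C" by (rule shift.ob[OF d(5)])
  let ?I = "Idt C (shift_ob C Y)"
  have I: "?I \<in> Hom C (shift_ob C Y) (shift_ob C Y)" by (rule idt_in[OF sY])
  have i: "Idt C Y \<in> Hom C Y Y" by (rule idt_in[OF d(5)])
  \<comment> \<open>The rotated identity triangle of \<open>Y\<close> is compared with
    \<open>t'\<close>. The signs on both third maps cancel, so the induced \<open>c\<close> is a
    right inverse of \<open>shift_mor C f\<close>.\<close>
  have u: "dist_triangle C Y Z (shift_ob C Y) (Zero C Y Z, Zero C Z (shift_ob C Y), neg C ?I)"
    using dist_triangle_rotate[OF dist_idt[OF d(5) Z]] shift.idt[OF d(5)] by simp
  have "Idt C Z \<cdot> Zero C Y Z = g \<cdot> Idt C Y"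
    using comp_idt_right[OF d(2)] comp_idt_left[OF zero_in[OF d(5,6)]]
      zero_objectD(1)[OF Z d(5) d(2) zero_in[OF d(5,6)]] by simp
  from dist_morphism[OF u t' i idt_in[OF d(6)] this]
  obtain c where c: "c \<in> Hom C (shift_ob C Y) (shift_ob C X)"
    "shift_mor C (Idt C Y) \<cdot> neg C ?I = neg C (shift_mor C f) \<cdot> c" by blast
  have "neg C ?I = neg C (shift_mor C f \<cdot> c)"
    using c(2) comp_idt_left[OF neg_in[OF sY sY I]] shift.idt[OF d(5)] comp_neg_left[OF c(1) sf]
    by simp
  then have "shift_mor C f \<cdot> c = ?I" using neg_neg I comp_in[OF c(1) sf] by metis
  then have "is_retract C (shift_ob C Y) (shift_ob C X)"
    using c sf unfolding is_retract_def by blast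
  then show "is_retract C Y X" using shift_retractD d by blast
qed

text \<open>The composite of comparison maps in the two directions differs from the identity by an
  \<open>n\<close> that factors through \<open>h\<close> and satisfies \<open>h \<cdot> n = 0\<close>, so \<open>n\<close> squares to zero.\<close>

lemma dist_triangle_cone_retract:
  assumes t: "dist_triangle C X Y Z (f, g, h)" and t': "dist_triangle C X Y' Z' (f', g', h')"
    and b: "b \<in> Hom C Y Y'" "is_iso C b" "b \<cdot> f = f'"
  shows "is_retract C Z Z'"
proof -
  note d = dist_triangleD[OF t] and d' = dist_triangleD[OF t']
  let ?i = "Idt C X"
  have i: "?i \<in> Hom C X X" by (rule idt_in[OF d(4)])
  obtain b' where b': "b' \<in> Hom C Y' Y" "b' \<cdot> b = Idt C Y"
    using iso_inverseE[OF b(2,1)] .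
  have b'f': "b' \<cdot> f' = f"
    using b(3) comp_assoc[OF d(1) b(1) b'(1)] b'(2) comp_idt_left[OF d(1)] by simp
  have "b \<cdot> f = f' \<cdot> ?i" using b(3) comp_idt_right[OF d'(1)] by simp
  from dist_morphism[OF t t' i b(1) this] obtain c where
    c: "c \<in> Hom C Z Z'" "c \<cdot> g = g' \<cdot> b" "shift_mor C ?i \<cdot> h = h' \<cdot> c" by blast
  have "b' \<cdot> f' = f \<cdot> ?i" using b'f' comp_idt_right[OF d(1)] by simp
  from dist_morphism[OF t' t i b'(1) this] obtain c' where
    c': "c' \<in> Hom C Z' Z" "c' \<cdot> g' = g \<cdot> b'" "shift_mor C ?i \<cdot> h' = h \<cdot> c'" by blast
  have si: "shift_mor C ?i = Idt C (shift_ob C X)" by (rule shift.idt[OF d(4)])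
  have hc: "h' \<cdot> c = h" "h \<cdot> c' = h'"
    using c(3) c'(3) si comp_idt_left[OF d(3)] comp_idt_left[OF d'(3)] by simp_all
  define e where "e = c' \<cdot> c"
  have e: "e \<in> Hom C Z Z" unfolding e_def by (rule comp_in[OF c(1) c'(1)])
  have eg: "e \<cdot> g = g"
  proof -
    have "e \<cdot> g = c' \<cdot> (g' \<cdot> b)"
      unfolding e_def using comp_assoc[OF d(2) c(1) c'(1)] c(2) by simp
    also have "\<dots> = (g \<cdot> b') \<cdot> b" using comp_assoc[OF b(1) d'(2) c'(1)] c'(2) by simp
    also have "\<dots> = g"
      using comp_assoc[OF b(1) b'(1) d(2)] b'(2) comp_idt_right[OF d(2)] by simp
    finally show ?thesis .
  qed
  have he: "h \<cdot> e = h" unfolding e_def using comp_assoc[OF c(1) c'(1) d(3)] hc by simp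
  let ?I = "Idt C Z"
  have I: "?I \<in> Hom C Z Z" by (rule idt_in[OF d(6)])
  define n where "n = Add C e (neg C ?I)"
  have nI: "neg C ?I \<in> Hom C Z Z" by (rule neg_in[OF d(6,6) I])
  have n: "n \<in> Hom C Z Z" unfolding n_def by (rule add_in[OF d(6,6) e nI])
  have e_n: "e = Add C n ?I"
    unfolding n_def using add_assoc[OF d(6,6) e nI I] add_neg_left[OF d(6,6) I]
      add_zero_right[OF d(6,6) e] by simp
  have sX: "shift_ob C X \<in> Obj C" by (rule shift.ob[OF d(4)])
  have "n \<cdot> g = Zero C Y Z"
    unfolding n_def using comp_add_left[OF d(2) e nI] comp_neg_left[OF d(2) I] eg
      comp_idt_left[OF d(2)] add_neg_right[OF d(5,6) d(2)] by simp
  from dist_triangle_factor[OF dist_triangle_rotate[OF t] n this]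
  obtain m where m: "m \<in> Hom C (shift_ob C X) Z" "m \<cdot> h = n" .
  have hn: "h \<cdot> n = Zero C Z (shift_ob C X)"
    unfolding n_def using comp_add_right[OF e nI d(3)] comp_neg_right[OF I d(3)] he
      comp_idt_right[OF d(3)] add_neg_right[OF d(6) sX d(3)] by simp
  have nn: "n \<cdot> n = Zero C Z Z"
    using comp_assoc[OF n d(3) m(1)] m(2) hn comp_zero_right[OF m(1) d(6)] by simp
  have nn': "neg C n \<in> Hom C Z Z" by (rule neg_in[OF d(6,6) n])
  \<comment> \<open>As \<open>n \<cdot> n\<close> vanishes, \<open>1 - n\<close> is a left inverse
    of \<open>e = 1 + n\<close>. Since \<open>e = c' \<cdot> c\<close>, the map
    \<open>q \<cdot> c'\<close> is then a retraction of \<open>c\<close>.\<close>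
  define q where "q = Add C ?I (neg C n)"
  have q: "q \<in> Hom C Z Z" unfolding q_def by (rule add_in[OF d(6,6) I nn'])
  have "neg C n \<cdot> e = neg C n"
  proof -
    have "n \<cdot> e = n"
      using comp_add_right[OF n I n] nn comp_idt_right[OF n] add_zero_left[OF d(6,6) n] e_n
      by simp
    then show ?thesis using comp_neg_left[OF e n] by simp
  qed
  then have "q \<cdot> e = Add C e (neg C n)"
    unfolding q_def using comp_add_left[OF e I nn'] comp_idt_left[OF e] by simp
  also have "\<dots> = Add C (Add C ?I n) (neg C n)"
  proof -
    interpret G: comm_group "hom_group C Z Z" by (rule hom_comm_group[OF d(6,6)])
    show ?thesis using e_n G.m_comm[unfolded hom_group_simps, OF n I] by simp
  qed
  also have "\<dots> = ?I"
    using add_assoc[OF d(6,6) I n nn'] add_neg_right[OF d(6,6) n] add_zero_right[OF d(6,6) I]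
    by simp
  finally have "(q \<cdot> c') \<cdot> c = ?I"
    unfolding e_def using comp_assoc[OF c(1) c'(1) q] by simp
  then show ?thesis using c(1) comp_in[OF c'(1) q] unfolding is_retract_def by blast
qed

end



section \<open>Closure properties and orthogonality up to retracts\<close>

context weight_structure
begin

text \<open>The axiom provides one zero object in the class, and any other is a retract of
  it.\<close>

lemma le_zero_object:
  assumes "zero_object C Z"
  shows "Z \<in> le"
  using le_zero zero_object_retract[OF assms] le_retract assms
  by (auto simp: zero_object_def)

lemma ge_zero_object:
  assumes "zero_object C Z"
  shows "Z \<in> ge"
  using ge_zero zero_object_retract[OF assms] ge_retract assms
  by (auto simp: zero_object_def)

lemma le_any_direct_sum:
  assumes "is_direct_sum C X Y S" "X \<in> le" "Y \<in> le"
  shows "S \<in> le"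
proof -
  obtain T where T: "T \<in> le" "is_direct_sum C X Y T" using le_direct_sum assms(2,3) by blast
  have "is_retract C S T" using direct_sum_retract[OF assms(1) T(2)] assms(2,3) le_sub by blast
  moreover have "S \<in> Obj C" using assms(1) by (simp add: is_direct_sum_def)
  ultimately show ?thesis using le_retract T(1) by blast
qed

lemma ge_any_direct_sum:
  assumes "is_direct_sum C X Y S" "X \<in> ge" "Y \<in> ge"
  shows "S \<in> ge"
proof -
  obtain T where T: "T \<in> ge" "is_direct_sum C X Y T" using ge_direct_sum assms(2,3) by blast
  have "is_retract C S T" using direct_sum_retract[OF assms(1) T(2)] assms(2,3) ge_sub by blast
  moreover have "S \<in> Obj C" using assms(1) by (simp add: is_direct_sum_def)
  ultimately show ?thesis using ge_retract T(1) by blast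
qed

lemma ge_unshift:
  assumes "shift_ob C X \<in> ge" "X \<in> Obj C"
  shows "X \<in> ge"
proof -
  obtain Y where "Y \<in> ge" "shift_ob C X = shift_ob C Y" using ge_shift assms(1) by blast
  then show ?thesis using shift_ob_inj[OF assms(2), of Y] ge_sub by auto
qed

text \<open>An exact functor commutes with the shift only up to isomorphism. Allowing a retract as
  target makes orthogonality applicable to the image of a shifted object.\<close>

lemma orthogonal_retract:
  assumes "X \<in> ge" "Y \<in> le" "is_retract C Z (shift_ob C Y)" "f \<in> Hom C X Z"
  shows "f = Zero C X Z"
proof -
  obtain s r where *: "s \<in> Hom C Z (shift_ob C Y)" "r \<in> Hom C (shift_ob C Y) Z" "r \<cdot> s = Idt C Z"
    using assms(3) unfolding is_retract_def by blast
  have "s \<cdot> f = Zero C X (shift_ob C Y)"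
    using comp_in[OF assms(4) *(1)] orthogonal[OF assms(1)] assms(2) by blast
  then show ?thesis
    using comp_assoc[OF assms(4) *(1,2)] *(3) comp_idt_left[OF assms(4)]
      comp_zero_right[OF *(2) HomD(4)[OF assms(4)]] by simp
qed

end


section \<open>Adjunctions: transposes and vanishing of maps\<close>

lemma adjunctionD:
  assumes "adjunction C D L R \<eta> \<epsilon>"
  shows "is_functor C D L" "is_functor D C R"
    and "X \<in> Obj C \<Longrightarrow> \<eta> X \<in> Hom C X (Fob R (Fob L X))"
    and "\<lbrakk>X \<in> Obj C; X' \<in> Obj C; f \<in> Hom C X X'\<rbrakk>
      \<Longrightarrow> Comp C (\<eta> X') f = Comp C (Fmor R (Fmor L f)) (\<eta> X)"
    and "Y \<in> Obj D \<Longrightarrow> \<epsilon> Y \<in> Hom D (Fob L (Fob R Y)) Y"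
    and "\<lbrakk>Y \<in> Obj D; Y' \<in> Obj D; g \<in> Hom D Y Y'\<rbrakk>
      \<Longrightarrow> Comp D (\<epsilon> Y') (Fmor L (Fmor R g)) = Comp D g (\<epsilon> Y)"
    and "X \<in> Obj C \<Longrightarrow> Comp D (\<epsilon> (Fob L X)) (Fmor L (\<eta> X)) = Idt D (Fob L X)"
    and "Y \<in> Obj D \<Longrightarrow> Comp C (Fmor R (\<epsilon> Y)) (\<eta> (Fob R Y)) = Idt C (Fob R Y)"
  using assms by (simp_all add: adjunction_def nat_trans_def func_id_def func_comp_def)

text \<open>Naturality of the counit moves it past \<open>f\<close>, and a triangle identity cancels
  what remains.\<close>

lemma adjunction_counit_transpose:
  assumes "category C" "category D" "adjunction C D L R \<eta> \<epsilon>"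
    and "X \<in> Obj C" "f \<in> Hom D (Fob L X) Y"
  shows "Comp D (\<epsilon> Y) (Fmor L (Comp C (Fmor R f) (\<eta> X))) = f"
proof -
  interpret C: category C by fact
  interpret D: category D by fact
  note A = adjunctionD[OF assms(3)]
  note L = functor_mor[OF assms(1) A(1)] and R = functor_mor[OF assms(2) A(2)]
  note Y = D.HomD(4,5)[OF assms(5)]
  note \<eta> = A(3)[OF assms(4)]
  have "Comp D (\<epsilon> Y) (Fmor L (Comp C (Fmor R f) (\<eta> X)))
      = Comp D (\<epsilon> Y) (Comp D (Fmor L (Fmor R f)) (Fmor L (\<eta> X)))"
    using functor_comp[OF assms(1) A(1) \<eta> R[OF assms(5)]] by simp
  also have "\<dots> = Comp D (Comp D f (\<epsilon> (Fob L X))) (Fmor L (\<eta> X))"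
    using D.comp_assoc[OF L[OF \<eta>] L[OF R[OF assms(5)]] A(5)[OF Y(2)]] A(6)[OF Y assms(5)] by simp
  also have "\<dots> = f"
    using D.comp_assoc[OF L[OF \<eta>] A(5)[OF Y(1)] assms(5)] A(7)[OF assms(4)]
      D.comp_idt_right[OF assms(5)] by simp
  finally show ?thesis .
qed

lemma adjunction_unit_transpose:
  assumes "category C" "category D" "adjunction C D L R \<eta> \<epsilon>"
    and "Y \<in> Obj D" "g \<in> Hom C X (Fob R Y)"
  shows "Comp C (Fmor R (Comp D (\<epsilon> Y) (Fmor L g))) (\<eta> X) = g"
proof -
  interpret C: category C by fact
  interpret D: category D by fact
  note A = adjunctionD[OF assms(3)]
  note L = functor_mor[OF assms(1) A(1)] and R = functor_mor[OF assms(2) A(2)]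
  note X = C.HomD(4,5)[OF assms(5)]
  note \<epsilon> = A(5)[OF assms(4)]
  have "Comp C (Fmor R (Comp D (\<epsilon> Y) (Fmor L g))) (\<eta> X)
      = Comp C (Comp C (Fmor R (\<epsilon> Y)) (Fmor R (Fmor L g))) (\<eta> X)"
    using functor_comp[OF assms(2) A(2) L[OF assms(5)] \<epsilon>] by simp
  also have "\<dots> = Comp C (Fmor R (\<epsilon> Y)) (Comp C (\<eta> (Fob R Y)) g)"
    using C.comp_assoc[OF A(3)[OF X(1)] R[OF L[OF assms(5)]] R[OF \<epsilon>]] A(4)[OF X assms(5)] by simp
  also have "\<dots> = g"
    using C.comp_assoc[OF assms(5) A(3)[OF X(2)] R[OF \<epsilon>]] A(8)[OF assms(4)]
      C.comp_idt_left[OF assms(5)] by simp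
  finally show ?thesis .
qed

text \<open>\<open>f\<close> is recovered from its transpose by applying \<open>F\<close> and
  composing with the counit; both operations send zero to zero.\<close>

lemma (in additive_functor_between) left_adjoint_zero:
  assumes "adjunction C D F R \<eta> \<epsilon>" "X \<in> Obj C" "f \<in> Hom D (Fob F X) Y"
    and zero': "\<And>g. g \<in> Hom C X (Fob R Y) \<Longrightarrow> g = Zero C X (Fob R Y)"
  shows "f = Zero D (Fob F X) Y"
proof -
  note A = adjunctionD[OF assms(1)]
  note R = functor_mor[OF D.category_axioms A(2)] functor_ob[OF D.category_axioms A(2)]
  have Y: "Y \<in> Obj D" using D.HomD[OF assms(3)] by blast
  have "Comp C (Fmor R f) (\<eta> X) = Zero C X (Fob R Y)"
    using zero' C.comp_in[OF A(3)[OF assms(2)] R(1)[OF assms(3)]] .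
  then show ?thesis
    using adjunction_counit_transpose[OF C.category_axioms D.category_axioms assms(1-3)]
      zero[OF assms(2) R(2)[OF Y]] D.comp_zero_right[OF A(5)[OF Y] ob[OF assms(2)]] by simp
qed

text \<open>Dually, \<open>g\<close> is recovered from its transpose by applying \<open>F\<close>
  and composing with the unit.\<close>

lemma (in additive_functor_between) right_adjoint_zero:
  assumes "adjunction D C L F \<eta> \<epsilon>" "Y \<in> Obj C" "g \<in> Hom D X (Fob F Y)"
    and zero': "\<And>f. f \<in> Hom C (Fob L X) Y \<Longrightarrow> f = Zero C (Fob L X) Y"
  shows "g = Zero D X (Fob F Y)"
proof -
  note A = adjunctionD[OF assms(1)]
  note L = functor_mor[OF D.category_axioms A(1)] functor_ob[OF D.category_axioms A(1)]
  have X: "X \<in> Obj D" using D.HomD[OF assms(3)] by blast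
  have "Comp C (\<epsilon> Y) (Fmor L g) = Zero C (Fob L X) Y"
    using zero' C.comp_in[OF L(1)[OF assms(3)] A(5)[OF assms(2)]] .
  then show ?thesis
    using adjunction_unit_transpose[OF D.category_axioms C.category_axioms assms(1-3)]
      zero[OF L(2)[OF X] assms(2)] D.comp_zero_left[OF A(3)[OF X] ob[OF assms(2)]] by simp
qed


section \<open>Exact functors and decomposition along an adjunction\<close>

locale exact_functor_between = C: triangulated_category C + D: triangulated_category D
  for C :: "('oc, 'mc, 'x) tri_data_scheme" and D :: "('od, 'md, 'y) tri_data_scheme"
    and F :: "('oc, 'mc, 'od, 'md) func" +
  assumes exact: "exact_functor C D F"
begin

sublocale additive_functor_between C D F
  using exact by unfold_locales (simp add: exact_functor_def)

lemma shift_retract: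
  assumes "X \<in> Obj C"
  shows "is_retract D (Fob F (shift_ob C X)) (shift_ob D (Fob F X))"
    and "is_retract D (shift_ob D (Fob F X)) (Fob F (shift_ob C X))"
proof -
  obtain \<phi> where \<phi>: "nat_iso C D (F \<circ>\<^sub>F Shift C) (Shift D \<circ>\<^sub>F F) \<phi>"
    using exact unfolding exact_functor_def by blast
  have "is_iso D (\<phi> X)" "\<phi> X \<in> Hom D (Fob F (shift_ob C X)) (shift_ob D (Fob F X))"
    using \<phi> assms by (simp_all add: nat_iso_def nat_trans_def func_comp_def)
  then show "is_retract D (Fob F (shift_ob C X)) (shift_ob D (Fob F X))"
    "is_retract D (shift_ob D (Fob F X)) (Fob F (shift_ob C X))"
    by (rule D.iso_imp_retract)+
qed

lemma dist_triangleE: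
  assumes "dist_triangle C X Y Z (f, g, h)"
  obtains k where "dist_triangle D (Fob F X) (Fob F Y) (Fob F Z) (Fmor F f, Fmor F g, k)"
  using exact assms unfolding exact_functor_def by blast

text \<open>One step of the decomposition, used for \<open>j_ust\<close> with \<open>j_lst\<close>
  and for \<open>i_ust\<close> with \<open>i_lst\<close>. The map from \<open>Fob F X\<close> to its
  part \<open>A\<close> is transposed to \<open>g\<close>, and \<open>W\<close> is the fibre of
  \<open>g\<close>. Applying \<open>F\<close> to \<open>g\<close> returns the original map up to the
  isomorphism \<open>\<epsilon> A\<close>, so the shifted image of \<open>W\<close> is a retract of
  the other part \<open>B\<close>.\<close>

lemma adjoint_decomposition:
  assumes adj: "adjunction C D F R \<eta> \<epsilon>" and iso: "\<And>A. A \<in> Obj D \<Longrightarrow> is_iso D (\<epsilon> A)"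
    and w: "weight_structure D w_le w_ge" and X: "X \<in> Obj C"
  obtains A W f g h where "A \<in> w_le" "dist_triangle C W X (Fob R A) (f, g, h)"
    "Fob F (shift_ob C W) \<in> w_ge"
proof -
  interpret w: weight_structure D w_le w_ge by fact
  note A = adjunctionD[OF adj]
  note R = functor_mor[OF D.category_axioms A(2)]
  obtain A B p q r where 1: "A \<in> w_le" "B \<in> w_ge"
    "dist_triangle D (unshift_ob D B) (Fob F X) A (p, q, r)"
    using w.decomposition[OF ob[OF X]] by blast
  note q = D.dist_triangleD(2)[OF 1(3)] and A' = D.dist_triangleD(6)[OF 1(3)]
  have B: "B \<in> Obj D" using 1(2) w.ge_sub by blast
  define g where "g = Comp C (Fmor R q) (\<eta> X)"
  have g: "g \<in> Hom C X (Fob R A)" unfolding g_def by (rule C.comp_in[OF A(3)[OF X] R[OF q]])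
  obtain W f h where W: "dist_triangle C W X (Fob R A) (f, g, h)"
    using C.dist_triangle_second_exists[OF g] .
  note W' = C.dist_triangleD(4)[OF W]
  obtain k where k: "dist_triangle D (Fob F W) (Fob F X) (Fob F (Fob R A)) (Fmor F f, Fmor F g, k)"
    using dist_triangleE[OF W] .
  have "Comp D (\<epsilon> A) (Fmor F g) = q"
    unfolding g_def
    using adjunction_counit_transpose[OF C.category_axioms D.category_axioms adj X q] .
  then have "is_retract D (shift_ob D (Fob F W)) (shift_ob D (unshift_ob D B))"
    using D.dist_triangle_cone_retract[OF D.dist_triangle_rotate[OF k]
        D.dist_triangle_rotate[OF 1(3)] A(5)[OF A'] iso[OF A']] by blast
  then have "is_retract D (Fob F (shift_ob C W)) B"
    using D.retract_trans[OF shift_retract(1)[OF W']] D.shift_unshift(2)[OF B] by simp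
  then have "Fob F (shift_ob C W) \<in> w_ge"
    using w.ge_retract[OF 1(2)] ob[OF C.shift.ob[OF W']] by blast
  then show ?thesis using that 1(1) W by blast
qed

end


section \<open>Verification of the weight structure axioms for the glued classes\<close>

theorem theorem8p2p3:
  fixes C :: "('oc, 'mc) tri_data"
    and D :: "('od, 'md) tri_data"
    and E :: "('oe, 'me) tri_data"
    and i_lst :: "('od, 'md, 'oc, 'mc) func"
    and j_ust :: "('oc, 'mc, 'oe, 'me) func"
    and i_ust i_ush :: "('oc, 'mc, 'od, 'md) func"
    and j_lsh j_lst :: "('oe, 'me, 'oc, 'mc) func"
    and D_le D_ge :: "'od set"
    and E_le E_ge :: "'oe set"
  assumes "gluing_data C D E i_lst j_ust i_ust i_ush j_lsh j_lst"
    and "weight_structure D D_le D_ge"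
    and "weight_structure E E_le E_ge"
  shows "weight_structure C
           {X \<in> Obj C. Fob i_ush X \<in> D_le \<and> Fob j_ust X \<in> E_le}
           {X \<in> Obj C. Fob i_ust X \<in> D_ge \<and> Fob j_ust X \<in> E_ge}"
proof -
  note G = assms(1)[unfolded gluing_data_def]
  have tri: "triangulated_category C" "triangulated_category D" "triangulated_category E"
    and ex: "exact_functor D C i_lst" "exact_functor C E j_ust" "exact_functor C D i_ust"
      "exact_functor C D i_ush" "exact_functor E C j_lsh" "exact_functor E C j_lst"
    and van: "\<And>X. X \<in> Obj E \<Longrightarrow> zero_object D (Fob i_ust (Fob j_lsh X))"
      "\<And>X. X \<in> Obj E \<Longrightarrow> zero_object D (Fob i_ush (Fob j_lst X))"
    using G by blast+
  obtain \<eta>1 \<epsilon>1 \<eta>2 \<epsilon>2 \<eta>3 \<epsilon>3 \<eta>4 \<epsilon>4 where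
    adj: "adjunction C D i_ust i_lst \<eta>1 \<epsilon>1" "adjunction D C i_lst i_ush \<eta>2 \<epsilon>2"
      "adjunction E C j_lsh j_ust \<eta>3 \<epsilon>3" "adjunction C E j_ust j_lst \<eta>4 \<epsilon>4"
    and tr: "\<And>X. X \<in> Obj C \<Longrightarrow> \<exists>h. dist_triangle C (Fob j_lsh (Fob j_ust X)) X
      (Fob i_lst (Fob i_ust X)) (\<epsilon>3 X, \<eta>1 X, h)"
    and ni: "nat_iso D D (i_ust \<circ>\<^sub>F i_lst) func_id \<epsilon>1" "nat_iso D D func_id (i_ush \<circ>\<^sub>F i_lst) \<eta>2"
      "nat_iso E E (j_ust \<circ>\<^sub>F j_lst) func_id \<epsilon>4"
    using G by (elim conjE exE) blast
  interpret C: triangulated_category C by (rule tri)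
  interpret D: weight_structure D D_le D_ge by fact
  interpret E: weight_structure E E_le E_ge by fact
  interpret il: exact_functor_between D C i_lst by unfold_locales (rule ex)
  interpret ju: exact_functor_between C E j_ust by unfold_locales (rule ex)
  interpret iu: exact_functor_between C D i_ust by unfold_locales (rule ex)
  interpret ih: exact_functor_between C D i_ush by unfold_locales (rule ex)
  interpret jh: exact_functor_between E C j_lsh by unfold_locales (rule ex)
  interpret jl: exact_functor_between E C j_lst by unfold_locales (rule ex)
  have iso: "\<And>A. A \<in> Obj D \<Longrightarrow> is_iso D (\<epsilon>1 A)" "\<And>A. A \<in> Obj D \<Longrightarrow> is_iso D (\<eta>2 A)"
    "\<And>A. A \<in> Obj E \<Longrightarrow> is_iso E (\<epsilon>4 A)"
    using ni by (simp_all add: nat_iso_def)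
  \<comment> \<open>The identity of \<open>?K\<close> transposes to a map from
    \<open>Fob j_lsh ?K\<close> to \<open>Fob i_lst A\<close>, and this one to a map out of
    \<open>Fob i_ust (Fob j_lsh ?K)\<close>, a zero object.\<close>
  have ju_il: "zero_object E (Fob j_ust (Fob i_lst A))" if A: "A \<in> Obj D" for A
  proof (rule E.zero_objectI)
    let ?K = "Fob j_ust (Fob i_lst A)"
    show K: "?K \<in> Obj E" by (rule ju.ob[OF il.ob[OF A]])
    have z: "f = Zero D (Fob i_ust (Fob j_lsh ?K)) A"
      if "f \<in> Hom D (Fob i_ust (Fob j_lsh ?K)) A" for f
      using D.zero_objectD(2)[OF van(1)[OF K] A that D.zero_in[OF iu.ob[OF jh.ob[OF K]] A]] .
    have "g = Zero C (Fob j_lsh ?K) (Fob i_lst A)"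
      if "g \<in> Hom C (Fob j_lsh ?K) (Fob i_lst A)" for g
      using il.right_adjoint_zero[OF adj(1) A that z] by blast
    then show "Idt E ?K = Zero E ?K ?K"
      using ju.right_adjoint_zero[OF adj(3) il.ob[OF A] E.idt_in[OF K]] by blast
  qed
  let ?le = "{X \<in> Obj C. Fob i_ush X \<in> D_le \<and> Fob j_ust X \<in> E_le}"
  let ?ge = "{X \<in> Obj C. Fob i_ust X \<in> D_ge \<and> Fob j_ust X \<in> E_ge}"
  show ?thesis
  proof (unfold_locales)
    show "?le \<subseteq> Obj C" "?ge \<subseteq> Obj C" by auto
  next
    obtain Z where "zero_object C Z" using C.zero_object_exists by blast
    then show "\<exists>Z \<in> ?le. zero_object C Z" "\<exists>Z \<in> ?ge. zero_object C Z"
      using D.le_zero_object[OF ih.zero_object] E.le_zero_object[OF ju.zero_object]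
        D.ge_zero_object[OF iu.zero_object] E.ge_zero_object[OF ju.zero_object]
      unfolding zero_object_def by blast+
  next
    fix X Y assume XY: "X \<in> ?le" "Y \<in> ?le"
    then obtain S where S: "is_direct_sum C X Y S" using C.direct_sum_exists by blast
    then have "S \<in> ?le"
      using XY D.le_any_direct_sum[OF ih.direct_sum[OF S]] E.le_any_direct_sum[OF ju.direct_sum[OF S]]
      by (auto simp: is_direct_sum_def)
    with S show "\<exists>S \<in> ?le. is_direct_sum C X Y S" by blast
  next
    fix X Y assume XY: "X \<in> ?ge" "Y \<in> ?ge"
    then obtain S where S: "is_direct_sum C X Y S" using C.direct_sum_exists by blast
    then have "S \<in> ?ge"
      using XY D.ge_any_direct_sum[OF iu.direct_sum[OF S]] E.ge_any_direct_sum[OF ju.direct_sum[OF S]]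
      by (auto simp: is_direct_sum_def)
    with S show "\<exists>S \<in> ?ge. is_direct_sum C X Y S" by blast
  next
    fix X Y assume "Y \<in> ?le" "X \<in> Obj C" "is_retract C X Y"
    then show "X \<in> ?le"
      using D.le_retract[OF _ ih.ob ih.retract] E.le_retract[OF _ ju.ob ju.retract] by blast
  next
    fix X Y assume "Y \<in> ?ge" "X \<in> Obj C" "is_retract C X Y"
    then show "X \<in> ?ge"
      using D.ge_retract[OF _ iu.ob iu.retract] E.ge_retract[OF _ ju.ob ju.retract] by blast
  next
    show "?ge \<subseteq> shift_ob C ` ?ge"
    proof
      fix X assume X: "X \<in> ?ge"
      then obtain Y where Y: "Y \<in> Obj C" "X = shift_ob C Y" using C.shift_obE by blast
      \<comment> \<open>Each shifted image of \<open>Y\<close> is a retract of the image of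
        \<open>X\<close>, hence lies in the class; \<open>ge_unshift\<close> then removes the
        shift.\<close>
      have "shift_ob D (Fob i_ust Y) \<in> D_ge"
        using D.ge_retract[OF _ D.shift.ob[OF iu.ob[OF Y(1)]] iu.shift_retract(2)[OF Y(1)]] X Y
        by blast
      moreover have "shift_ob E (Fob j_ust Y) \<in> E_ge"
        using E.ge_retract[OF _ E.shift.ob[OF ju.ob[OF Y(1)]] ju.shift_retract(2)[OF Y(1)]] X Y
        by blast
      ultimately have "Y \<in> ?ge"
        using D.ge_unshift[OF _ iu.ob[OF Y(1)]] E.ge_unshift[OF _ ju.ob[OF Y(1)]] Y(1) by blast
      with Y show "X \<in> shift_ob C ` ?ge" by blast
    qed
  next
    show "shift_ob C ` ?le \<subseteq> ?le"
    proof
      fix X assume "X \<in> shift_ob C ` ?le"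
      then obtain Y where Y: "Y \<in> ?le" "X = shift_ob C Y" by blast
      then have YC: "Y \<in> Obj C" by blast
      have "shift_ob D (Fob i_ush Y) \<in> D_le" "shift_ob E (Fob j_ust Y) \<in> E_le"
        using Y D.le_shift E.le_shift by blast+
      then show "X \<in> ?le"
        using D.le_retract[OF _ ih.ob[OF C.shift.ob[OF YC]] ih.shift_retract(1)[OF YC]]
          E.le_retract[OF _ ju.ob[OF C.shift.ob[OF YC]] ju.shift_retract(1)[OF YC]]
          C.shift.ob[OF YC] Y(2) by blast
    qed
  next
    fix X Y assume X: "X \<in> ?ge" and "Y \<in> shift_ob C ` ?le"
    then obtain T where T: "T \<in> ?le" "Y = shift_ob C T" by blast
    have o: "X \<in> Obj C" "T \<in> Obj C" "Y \<in> Obj C" using X T C.shift.ob by auto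
    obtain h where h: "dist_triangle C (Fob j_lsh (Fob j_ust X)) X (Fob i_lst (Fob i_ust X))
      (\<epsilon>3 X, \<eta>1 X, h)" using tr[OF o(1)] by blast
    have "f = Zero C X Y" if f: "f \<in> Hom C X Y" for f
    proof -
      \<comment> \<open>Maps from \<open>Fob j_lsh (Fob j_ust X)\<close> to \<open>Y\<close> are
        transposes of such \<open>g\<close>. Their vanishing makes \<open>f\<close> factor through
        the third term of the triangle.\<close>
      have "g = Zero E (Fob j_ust X) (Fob j_ust Y)"
        if "g \<in> Hom E (Fob j_ust X) (Fob j_ust Y)" for g
        using E.orthogonal_retract[OF _ _ ju.shift_retract(1)[OF o(2)]] that X T by blast
      then have "Comp C f (\<epsilon>3 X) = Zero C (Fob j_lsh (Fob j_ust X)) Y"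
        using jh.left_adjoint_zero[OF adj(3) ju.ob[OF o(1)]
            C.comp_in[OF C.dist_triangleD(1)[OF h] f]] by blast
      then obtain c where c: "c \<in> Hom C (Fob i_lst (Fob i_ust X)) Y" "Comp C c (\<eta>1 X) = f"
        using C.dist_triangle_factor[OF h f] by blast
      \<comment> \<open>The factor \<open>c\<close> leaves an object in the image of
        \<open>i_lst\<close>, so here the adjunction with \<open>i_ush\<close> on the right is the
        one to use.\<close>
      have "g = Zero D (Fob i_ust X) (Fob i_ush Y)"
        if "g \<in> Hom D (Fob i_ust X) (Fob i_ush Y)" for g
        using D.orthogonal_retract[OF _ _ ih.shift_retract(1)[OF o(2)]] that X T by blast
      then have "c = Zero C (Fob i_lst (Fob i_ust X)) Y"
        using il.left_adjoint_zero[OF adj(2) iu.ob[OF o(1)] c(1)] by blast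
      with c(2) show ?thesis using C.comp_zero_left[OF C.dist_triangleD(2)[OF h] o(3)] by simp
    qed
    then show "Hom C X Y = {Zero C X Y}" using C.zero_in[OF o(1,3)] by blast
  next
    fix X assume X: "X \<in> Obj C"
    obtain P Y f g h where P: "P \<in> E_le" and Y: "dist_triangle C Y X (Fob j_lst P) (f, g, h)"
      and Yge: "Fob j_ust (shift_ob C Y) \<in> E_ge"
      using ju.adjoint_decomposition[OF adj(4) iso(3) assms(3) X] by blast
    note YC = C.dist_triangleD(4)[OF Y]
    obtain Q W f' g' h' where Q: "Q \<in> D_le"
      and W: "dist_triangle C W Y (Fob i_lst Q) (f', g', h')"
      and Wge: "Fob i_ust (shift_ob C W) \<in> D_ge"
      using iu.adjoint_decomposition[OF adj(1) iso(1) assms(2) YC] by blast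
    note WC = C.dist_triangleD(4)[OF W]
    have PE: "P \<in> Obj E" and QD: "Q \<in> Obj D" using P Q E.le_sub D.le_sub by auto
    obtain A k k' where A: "dist_triangle C W X A (Comp C f f', k, k')"
      using C.dist_complete[OF C.comp_in[OF C.dist_triangleD(1)[OF W] C.dist_triangleD(1)[OF Y]]]
      by blast
    note AC = C.dist_triangleD(6)[OF A]
    \<comment> \<open>The octahedron is applied to \<open>f'\<close> with cone
      \<open>Fob i_lst Q\<close>, to \<open>f\<close> with cone \<open>Fob j_lst P\<close>, and to
      their composite with cone \<open>A\<close>.\<close>
    obtain u v w where t: "dist_triangle C (Fob i_lst Q) A (Fob j_lst P) (u, v, w)"
      using C.octahedron[OF W Y A] by blast
    have "A \<in> ?le"
    proof -
      obtain k where "dist_triangle D (Fob i_ush (Fob i_lst Q)) (Fob i_ush A)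
          (Fob i_ush (Fob j_lst P)) (Fmor i_ush u, Fmor i_ush v, k)" using ih.dist_triangleE[OF t] .
      \<comment> \<open>Since \<open>i_ush\<close> kills \<open>Fob j_lst P\<close>, only the first
        term of \<open>t\<close> contributes, and the unit \<open>\<eta>2\<close> identifies its
        image with \<open>Q\<close>.\<close>
      from D.dist_triangle_zero_third(2)[OF this van(2)[OF PE]]
      have "is_retract D (Fob i_ush A) (Fob i_ush (Fob i_lst Q))" .
      moreover have "is_retract D (Fob i_ush (Fob i_lst Q)) Q"
        using D.iso_imp_retract(2)[OF iso(2)[OF QD] adjunctionD(3)[OF adj(2) QD]] .
      ultimately have 1: "Fob i_ush A \<in> D_le"
        using D.le_retract[OF Q ih.ob[OF AC]] D.retract_trans by blast
      obtain k where "dist_triangle E (Fob j_ust (Fob i_lst Q)) (Fob j_ust A)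
          (Fob j_ust (Fob j_lst P)) (Fmor j_ust u, Fmor j_ust v, k)" using ju.dist_triangleE[OF t] .
      \<comment> \<open>Since \<open>j_ust\<close> kills \<open>Fob i_lst Q\<close>, only the third
        term of \<open>t\<close> contributes, and the counit \<open>\<epsilon>4\<close> identifies
        its image with \<open>P\<close>.\<close>
      from E.dist_triangle_zero_first[OF this ju_il[OF QD]]
      have "is_retract E (Fob j_ust A) (Fob j_ust (Fob j_lst P))" .
      moreover have "is_retract E (Fob j_ust (Fob j_lst P)) P"
        using E.iso_imp_retract(1)[OF iso(3)[OF PE] adjunctionD(5)[OF adj(4) PE]] .
      ultimately have "Fob j_ust A \<in> E_le"
        using E.le_retract[OF P ju.ob[OF AC]] E.retract_trans by blast
      with 1 AC show ?thesis by blast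
    qed
    moreover have "shift_ob C W \<in> ?ge"
    proof -
      obtain k where "dist_triangle E (Fob j_ust W) (Fob j_ust Y)
          (Fob j_ust (Fob i_lst Q)) (Fmor j_ust f', Fmor j_ust g', k)"
        using ju.dist_triangleE[OF W] .
      \<comment> \<open>The second decomposition changes \<open>Y\<close> only by an object that
        \<open>j_ust\<close> kills, so the membership \<open>Yge\<close> from the first one passes
        to \<open>W\<close>.\<close>
      from E.shift.retract[OF E.dist_triangle_zero_third(1)[OF this ju_il[OF QD]]]
      have "is_retract E (shift_ob E (Fob j_ust W)) (shift_ob E (Fob j_ust Y))" .
      then have "is_retract E (Fob j_ust (shift_ob C W)) (Fob j_ust (shift_ob C Y))"
        using ju.shift_retract[OF WC] ju.shift_retract[OF YC] E.retract_trans by blast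
      then have "Fob j_ust (shift_ob C W) \<in> E_ge"
        using E.ge_retract[OF Yge ju.ob[OF C.shift.ob[OF WC]]] by blast
      with Wge C.shift.ob[OF WC] show ?thesis by blast
    qed
    \<comment> \<open>The witness for \<open>B\<close> is the shift of \<open>W\<close>, whose
      unshift is \<open>W\<close> again.\<close>
    moreover have "dist_triangle C (unshift_ob C (shift_ob C W)) X A (Comp C f f', k, k')"
      using A C.unshift_shift[OF WC] by simp
    ultimately show "\<exists>A \<in> ?le. \<exists>B \<in> ?ge. \<exists>f g h. dist_triangle C (unshift_ob C B) X A (f, g, h)"
      by blast
  qed
qed

end
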